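(* Let $I=(0,1)$, let $H\in C^1(\bar I)$ with $H>0$ and let $\tilde u\in C^2(\bar I)$ be real-valued and strictly monotonic in $\lambda$. Let $A_0:L^2(I)^2\to L^2(I)^2$ be the bounded operator $$A_0\begin{pmatrix}\phi_1\\ \phi_2\end{pmatrix}=\begin{pmatrix}\tilde u\,\phi_1+H\phi_2\\ g\int_0^1\phi_1\,\mathrm{d}\lambda+\tilde u\,\phi_2\end{pmatrix}.$$ If the vorticity $\tilde\omega=\partial_\lambda\tilde u/H$ satisfies either 1. $\partial_\lambda\tilde\omega\neq0$ for all $\lambda\in\bar I$, or 2. there exists $\lambda_c\in I$ such that $\partial_\lambda\tilde\omega(\lambda_c)=0$ and $\partial_\lambda\tilde\omega\,\bigl(\tilde u-\tilde u(\lambda_c)\bigr)>0$ for all $\lambda\neq\lambda_c$, then $$\sigma_p(A_0)=\sigma_d(A_0)=\{c_-,c_+\},\qquad \sigma_c(A_0)=\sigma_e(A_0)=\tilde u(\bar I),\qquad \sigma_r(A_0)=\emptyset,$$ where $c_-$ and $c_+$ are the two real eigenvalues of $A_0$ lying respectively in $J_-$ and $J_+$ (see context).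
   Context: $g>0$ is a constant; $\bar I=[0,1]$; $L^2(I)$ is the space of complex-valued square integrable functions. With $\tilde u_-=\inf_I\tilde u$, $\tilde u_+=\sup_I\tilde u$, $h=\int_0^1H\,\mathrm{d}\lambda$, set $J_-=[\tilde u_--\sqrt{gh},\tilde u_-)$ and $J_+=(\tilde u_+,\tilde u_++\sqrt{gh}]$; $c_-\in J_-$ and $c_+\in J_+$ are the unique solutions in $J_-$, respectively $J_+$, of $\int_0^1\frac{gH}{(c-\tilde u)^2}\,\mathrm{d}\lambda=1$ (they exist and are unique for $\tilde u\in C^{0,1/2}(\bar I)$ and $H\in L^\infty(I)$ with $\inf_I H>0$, hence here). For a bounded operator $A$ and $\mathbf{I}$ the identity: $\sigma_p(A)$ is the set of $c\in\mathbb{C}$ such that $A-c\mathbf{I}$ is not injective; $\sigma_c(A)$ the set of $c$ such that $A-c\mathbf{I}$ is injective with range dense but not equal to the whole space; $\sigma_r(A)$ the set of $c$ such that $A-c\mathbf{I}$ is injective with non-dense range; $\sigma_d(A)$ the set of $c$ such that $A-c\mathbf{I}$ is not invertible but Fredholm; $\sigma_e(A)$ the set of $c$ such that $A-c\mathbf{I}$ is not Fredholm. *)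

theory Defs
  imports "HOL-Analysis.Analysis"
begin

section \<open>The complex Hilbert space of square integrable functions on the unit interval\<close>

abbreviation unit_measure :: "real measure" where
  "unit_measure \<equiv> lebesgue_on {0<..<1}"

definition square_integrable :: "(real \<Rightarrow> complex) \<Rightarrow> bool" where
  "square_integrable f \<longleftrightarrow>
     f \<in> borel_measurable unit_measure \<and> integrable unit_measure (\<lambda>x. (cmod (f x))\<^sup>2)"

definition l2_eq :: "(real \<Rightarrow> complex) \<Rightarrow> (real \<Rightarrow> complex) \<Rightarrow> bool" where
  "l2_eq f h \<longleftrightarrow>
     square_integrable f \<and> square_integrable h \<and> (AE x in unit_measure. f x = h x)"

lemma square_integrable_zero: "square_integrable (\<lambda>x. 0)"
  by (simp add: square_integrable_def)

lemma square_integrable_add: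
  assumes "square_integrable f" "square_integrable h"
  shows "square_integrable (\<lambda>x. f x + h x)"
proof -
  have m: "f \<in> borel_measurable unit_measure" "h \<in> borel_measurable unit_measure"
    using assms by (auto simp: square_integrable_def)
  have "integrable unit_measure (\<lambda>x. 2 * (cmod (f x))\<^sup>2 + 2 * (cmod (h x))\<^sup>2)"
    using assms by (auto simp: square_integrable_def)
  moreover have "AE x in unit_measure.
      norm ((cmod (f x + h x))\<^sup>2) \<le> norm (2 * (cmod (f x))\<^sup>2 + 2 * (cmod (h x))\<^sup>2)"
  proof (rule AE_I2)
    fix x
    have "(cmod (f x + h x))\<^sup>2 \<le> (cmod (f x) + cmod (h x))\<^sup>2"
      by (intro power_mono norm_triangle_ineq) auto
    also have "\<dots> \<le> 2 * (cmod (f x))\<^sup>2 + 2 * (cmod (h x))\<^sup>2"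
      using sum_squares_bound[of "cmod (f x)" "cmod (h x)"] by (simp add: power2_sum)
    finally show "norm ((cmod (f x + h x))\<^sup>2) \<le> norm (2 * (cmod (f x))\<^sup>2 + 2 * (cmod (h x))\<^sup>2)"
      by simp
  qed
  moreover have "(\<lambda>x. (cmod (f x + h x))\<^sup>2) \<in> borel_measurable unit_measure"
    using m by measurable
  ultimately have "integrable unit_measure (\<lambda>x. (cmod (f x + h x))\<^sup>2)"
    using Bochner_Integration.integrable_bound by blast
  then show ?thesis using m by (auto simp: square_integrable_def)
qed

lemma square_integrable_bounded_mult:
  assumes f: "square_integrable f" and w: "w \<in> borel_measurable unit_measure"
    and B: "\<And>x. x \<in> {0<..<1} \<Longrightarrow> cmod (w x) \<le> B"
  shows "square_integrable (\<lambda>x. w x * f x)"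
proof -
  have m: "f \<in> borel_measurable unit_measure"
    using f by (auto simp: square_integrable_def)
  have "integrable unit_measure (\<lambda>x. B\<^sup>2 * (cmod (f x))\<^sup>2)"
    using f by (auto simp: square_integrable_def)
  moreover have "AE x in unit_measure. norm ((cmod (w x * f x))\<^sup>2) \<le> norm (B\<^sup>2 * (cmod (f x))\<^sup>2)"
    by (rule AE_I2) (auto simp: norm_mult power_mult_distrib intro!: mult_right_mono power_mono B)
  moreover have "(\<lambda>x. (cmod (w x * f x))\<^sup>2) \<in> borel_measurable unit_measure"
    using m w by measurable
  ultimately have "integrable unit_measure (\<lambda>x. (cmod (w x * f x))\<^sup>2)"
    using Bochner_Integration.integrable_bound by blast
  then show ?thesis using m w by (auto simp: square_integrable_def)
qed

lemma square_integrable_const: "square_integrable (\<lambda>x. a)"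
  by (simp add: square_integrable_def finite_measure.integrable_const finite_measureI
      emeasure_restrict_space)

lemma square_integrable_mult_left:
  "square_integrable f \<Longrightarrow> square_integrable (\<lambda>x. a * f x)"
  by (rule square_integrable_bounded_mult[where B = "cmod a"]) auto

lemma square_integrable_uminus:
  "square_integrable f \<Longrightarrow> square_integrable (\<lambda>x. - f x)"
  by (simp add: square_integrable_def)

lemma square_integrable_inner:
  assumes "square_integrable f" "square_integrable h"
  shows "integrable unit_measure (\<lambda>x. f x \<bullet> h x)"
proof -
  have m: "f \<in> borel_measurable unit_measure" "h \<in> borel_measurable unit_measure"
    using assms by (auto simp: square_integrable_def)
  have "integrable unit_measure (\<lambda>x. (cmod (f x))\<^sup>2 + (cmod (h x))\<^sup>2)"
    using assms by (auto simp: square_integrable_def)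
  moreover have "AE x in unit_measure.
      norm (f x \<bullet> h x) \<le> norm ((cmod (f x))\<^sup>2 + (cmod (h x))\<^sup>2)"
  proof (rule AE_I2)
    fix x
    have "\<bar>f x \<bullet> h x\<bar> \<le> cmod (f x) * cmod (h x)"
      by (rule Cauchy_Schwarz_ineq2)
    also have "\<dots> \<le> (cmod (f x))\<^sup>2 + (cmod (h x))\<^sup>2"
      using sum_squares_bound[of "cmod (f x)" "cmod (h x)"]
        mult_nonneg_nonneg[OF norm_ge_zero[of "f x"] norm_ge_zero[of "h x"]] by linarith
    finally show "norm (f x \<bullet> h x) \<le> norm ((cmod (f x))\<^sup>2 + (cmod (h x))\<^sup>2)" by simp
  qed
  moreover have "(\<lambda>x. f x \<bullet> h x) \<in> borel_measurable unit_measure"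
    using m by measurable
  ultimately show ?thesis
    using Bochner_Integration.integrable_bound by blast
qed

lemma part_equivp_l2_eq: "part_equivp l2_eq"
proof (rule part_equivpI)
  show "\<exists>x. l2_eq x x"
    by (rule exI[of _ "\<lambda>x. 0"]) (simp add: l2_eq_def square_integrable_zero)
  show "symp l2_eq"
    by (auto simp: symp_def l2_eq_def eq_commute)
  show "transp l2_eq"
    by (auto simp: transp_def l2_eq_def elim: AE_mp)
qed

quotient_type L2I = "real \<Rightarrow> complex" / partial: l2_eq
  by (rule part_equivp_l2_eq)

instantiation L2I :: real_inner
begin

lift_definition zero_L2I :: L2I is "\<lambda>x. 0"
  by (simp add: l2_eq_def square_integrable_zero)

lift_definition plus_L2I :: "L2I \<Rightarrow> L2I \<Rightarrow> L2I" is "\<lambda>f h x. f x + h x"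
  by (auto simp: l2_eq_def intro: square_integrable_add elim: AE_mp)

lift_definition uminus_L2I :: "L2I \<Rightarrow> L2I" is "\<lambda>f x. - f x"
  by (auto simp: l2_eq_def intro: square_integrable_uminus elim: AE_mp)

definition minus_L2I :: "L2I \<Rightarrow> L2I \<Rightarrow> L2I" where
  "minus_L2I \<phi> \<psi> = \<phi> + - \<psi>"

lift_definition scaleR_L2I :: "real \<Rightarrow> L2I \<Rightarrow> L2I" is "\<lambda>r f x. complex_of_real r * f x"
  by (auto simp: l2_eq_def intro: square_integrable_mult_left elim: AE_mp)

lift_definition inner_L2I :: "L2I \<Rightarrow> L2I \<Rightarrow> real" is "\<lambda>f h. LINT x|unit_measure. f x \<bullet> h x"
proof -
  fix f f' h h' assume a: "l2_eq f f'" "l2_eq h h'"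
  have "AE x in unit_measure. f x \<bullet> h x = f' x \<bullet> h' x"
    using a by (auto simp: l2_eq_def elim: AE_mp)
  moreover have "(\<lambda>x. f x \<bullet> h x) \<in> borel_measurable unit_measure"
    "(\<lambda>x. f' x \<bullet> h' x) \<in> borel_measurable unit_measure"
    using a square_integrable_inner unfolding l2_eq_def by auto
  ultimately show "(LINT x|unit_measure. f x \<bullet> h x) = (LINT x|unit_measure. f' x \<bullet> h' x)"
    by (rule integral_cong_AE[rotated 2])
qed

definition norm_L2I :: "L2I \<Rightarrow> real" where
  "norm_L2I \<phi> = sqrt (\<phi> \<bullet> \<phi>)"

definition sgn_L2I :: "L2I \<Rightarrow> L2I" where
  "sgn_L2I \<phi> = inverse (norm \<phi>) *\<^sub>R \<phi>"

definition dist_L2I :: "L2I \<Rightarrow> L2I \<Rightarrow> real" where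
  "dist_L2I \<phi> \<psi> = norm (\<phi> - \<psi>)"

definition uniformity_L2I :: "(L2I \<times> L2I) filter" where
  "uniformity_L2I = (INF e\<in>{0<..}. principal {(x, y). dist x y < e})"

definition open_L2I :: "L2I set \<Rightarrow> bool" where
  "open_L2I U \<longleftrightarrow> (\<forall>x\<in>U. eventually (\<lambda>(x', y). x' = x \<longrightarrow> y \<in> U) uniformity)"

instance
proof
  fix a b c :: L2I and r s :: real
  show "a + b + c = a + (b + c)"
    by transfer (auto simp: l2_eq_def add.assoc intro!: square_integrable_add)
  show "a + b = b + a"
    by transfer (auto simp: l2_eq_def add.commute intro!: square_integrable_add)
  show "0 + a = a"
    by transfer (auto simp: l2_eq_def)
  show "- a + a = 0"
    by transfer (auto simp: l2_eq_def square_integrable_zero)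
  show "a - b = a + - b"
    by (rule minus_L2I_def)
  show "r *\<^sub>R (a + b) = r *\<^sub>R a + r *\<^sub>R b"
    by transfer (auto simp: l2_eq_def distrib_left
        intro!: square_integrable_add square_integrable_mult_left)
  show "(r + s) *\<^sub>R a = r *\<^sub>R a + s *\<^sub>R a"
    by transfer (auto simp: l2_eq_def distrib_right
        intro!: square_integrable_add square_integrable_mult_left)
  show "r *\<^sub>R s *\<^sub>R a = (r * s) *\<^sub>R a"
    by transfer (auto simp: l2_eq_def mult.assoc intro!: square_integrable_mult_left)
  show "1 *\<^sub>R a = a"
    by transfer (auto simp: l2_eq_def)
  show "a \<bullet> b = b \<bullet> a"
    by transfer (simp add: inner_commute)
  show "(a + b) \<bullet> c = a \<bullet> c + b \<bullet> c"
    by transfer (simp add: inner_add_left l2_eq_def square_integrable_inner)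
  show "r *\<^sub>R a \<bullet> b = r * (a \<bullet> b)"
    by transfer (simp add: l2_eq_def flip: scaleR_conv_of_real)
  show "0 \<le> a \<bullet> a"
    by transfer simp
  show "a \<bullet> a = 0 \<longleftrightarrow> a = 0"
  proof transfer
    fix f assume "l2_eq f f"
    then have f: "square_integrable f" by (simp add: l2_eq_def)
    have "(LINT x|unit_measure. f x \<bullet> f x) = 0 \<longleftrightarrow> (AE x in unit_measure. f x \<bullet> f x = 0)"
      by (rule integral_nonneg_eq_0_iff_AE) (use square_integrable_inner[OF f f] in auto)
    then show "(LINT x|unit_measure. f x \<bullet> f x) = 0 \<longleftrightarrow> l2_eq f (\<lambda>x. 0)"
      using f by (simp add: l2_eq_def square_integrable_zero)
  qed
  show "norm a = sqrt (a \<bullet> a)"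
    by (rule norm_L2I_def)
  show "sgn a = inverse (norm a) *\<^sub>R a"
    by (rule sgn_L2I_def)
  show "dist a b = norm (a - b)"
    by (rule dist_L2I_def)
  show "(uniformity :: (L2I \<times> L2I) filter) = (INF e\<in>{0<..}. principal {(x, y). dist x y < e})"
    by (rule uniformity_L2I_def)
  show "open U \<longleftrightarrow> (\<forall>x\<in>U. eventually (\<lambda>(x', y). x' = x \<longrightarrow> y \<in> U) uniformity)" for U :: "L2I set"
    by (rule open_L2I_def)
qed

end

lemma norm_L2I_abs:
  assumes "square_integrable f"
  shows "norm (abs_L2I f) = sqrt (LINT x|unit_measure. (cmod (f x))\<^sup>2)"
proof -
  have "l2_eq f f" using assms by (simp add: l2_eq_def)
  then show ?thesis
    by (simp add: norm_L2I_def inner_L2I.abs_eq power2_norm_eq_inner)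
qed

lemma l2_eq_rep_L2I: "l2_eq (rep_L2I \<phi>) (rep_L2I \<phi>)"
  by (rule Quotient_rep_reflp[OF Quotient_L2I])

lemma rep_abs_L2I_AE:
  assumes "square_integrable f"
  shows "AE x in unit_measure. rep_L2I (abs_L2I f) x = f x"
proof -
  have "l2_eq f f" using assms by (simp add: l2_eq_def)
  then have "l2_eq (rep_L2I (abs_L2I f)) f"
    by (rule Quotient_rep_abs[OF Quotient_L2I])
  then show ?thesis by (simp add: l2_eq_def)
qed

section \<open>Complex normed spaces and spectra\<close>

class complex_normed_space = real_normed_vector +
  fixes scaleC :: "complex \<Rightarrow> 'a \<Rightarrow> 'a"
  assumes scaleC_add_right: "scaleC a (x + y) = scaleC a x + scaleC a y"
    and scaleC_add_left: "scaleC (a + b) x = scaleC a x + scaleC b x"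
    and scaleC_scaleC: "scaleC a (scaleC b x) = scaleC (a * b) x"
    and scaleC_one: "scaleC 1 x = x"
    and scaleR_eq_scaleC: "r *\<^sub>R x = scaleC (complex_of_real r) x"
    and norm_scaleC: "norm (scaleC a x) = cmod a * norm x"

global_interpretation complex_vector:
  vector_space "scaleC :: complex \<Rightarrow> 'a \<Rightarrow> 'a::complex_normed_space"
  by unfold_locales (simp_all add: scaleC_add_right scaleC_add_left scaleC_scaleC scaleC_one)

instantiation L2I :: complex_normed_space
begin

lift_definition scaleC_L2I :: "complex \<Rightarrow> L2I \<Rightarrow> L2I" is "\<lambda>c f x. c * f x"
  by (auto simp: l2_eq_def intro: square_integrable_mult_left elim: AE_mp)

instance
proof
  fix a b :: complex and x y :: L2I and r :: real
  show "scaleC a (x + y) = scaleC a x + scaleC a y"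
    by transfer (auto simp: l2_eq_def distrib_left
        intro!: square_integrable_add square_integrable_mult_left)
  show "scaleC (a + b) x = scaleC a x + scaleC b x"
    by transfer (auto simp: l2_eq_def distrib_right
        intro!: square_integrable_add square_integrable_mult_left)
  show "scaleC a (scaleC b x) = scaleC (a * b) x"
    by transfer (auto simp: l2_eq_def mult.assoc intro!: square_integrable_mult_left)
  show "scaleC 1 x = x"
    by transfer (auto simp: l2_eq_def)
  show "r *\<^sub>R x = scaleC (complex_of_real r) x"
    by transfer (auto simp: l2_eq_def intro!: square_integrable_mult_left)
  have "scaleC a x \<bullet> scaleC a x = (cmod a)\<^sup>2 * (x \<bullet> x)"
    by transfer (simp add: norm_mult power_mult_distrib flip: power2_norm_eq_inner)
  then show "norm (scaleC a x) = cmod a * norm x"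
    by (simp add: norm_L2I_def real_sqrt_mult)
qed

end

instantiation prod :: (complex_normed_space, complex_normed_space) complex_normed_space
begin

definition scaleC_prod :: "complex \<Rightarrow> 'a \<times> 'b \<Rightarrow> 'a \<times> 'b" where
  "scaleC_prod c x = (scaleC c (fst x), scaleC c (snd x))"

instance
proof
  fix a b :: complex and x y :: "'a \<times> 'b" and r :: real
  show "norm (scaleC a x) = cmod a * norm x"
    by (simp add: scaleC_prod_def norm_prod_def norm_scaleC power_mult_distrib real_sqrt_mult
        flip: distrib_left)
qed (auto simp: scaleC_prod_def scaleC_add_right scaleC_add_left scaleC_scaleC scaleC_one
    scaleR_eq_scaleC prod_eq_iff)

end

definition shift :: "('a::complex_normed_space \<Rightarrow> 'a) \<Rightarrow> complex \<Rightarrow> 'a \<Rightarrow> 'a" where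
  "shift A c = (\<lambda>x. A x - scaleC c x)"

definition invertible_op :: "('a::complex_normed_space \<Rightarrow> 'a) \<Rightarrow> bool" where
  "invertible_op T \<longleftrightarrow> (\<exists>S. bounded_linear S \<and> (\<forall>x. S (T x) = x) \<and> (\<forall>x. T (S x) = x))"

text \<open>Finite-dimensional kernel, closed range, and finite codimension of the range.\<close>

definition fredholm_op :: "('a::complex_normed_space \<Rightarrow> 'a) \<Rightarrow> bool" where
  "fredholm_op T \<longleftrightarrow>
     (\<exists>B. finite B \<and> {x. T x = 0} = complex_vector.span B) \<and>
     closed (range T) \<and>
     (\<exists>B. finite B \<and> complex_vector.span (range T \<union> B) = UNIV)"

definition point_spectrum :: "('a::complex_normed_space \<Rightarrow> 'a) \<Rightarrow> complex set" where
  "point_spectrum A = {c. \<not> inj (shift A c)}"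

definition continuous_spectrum :: "('a::complex_normed_space \<Rightarrow> 'a) \<Rightarrow> complex set" where
  "continuous_spectrum A =
     {c. inj (shift A c) \<and> closure (range (shift A c)) = UNIV \<and> range (shift A c) \<noteq> UNIV}"

definition residual_spectrum :: "('a::complex_normed_space \<Rightarrow> 'a) \<Rightarrow> complex set" where
  "residual_spectrum A = {c. inj (shift A c) \<and> closure (range (shift A c)) \<noteq> UNIV}"

definition discrete_spectrum :: "('a::complex_normed_space \<Rightarrow> 'a) \<Rightarrow> complex set" where
  "discrete_spectrum A = {c. \<not> invertible_op (shift A c) \<and> fredholm_op (shift A c)}"

definition essential_spectrum :: "('a::complex_normed_space \<Rightarrow> 'a) \<Rightarrow> complex set" where
  "essential_spectrum A = {c. \<not> fredholm_op (shift A c)}"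

section \<open>Functions on the closed unit interval\<close>

text \<open>The derivative is one-sided at the endpoints; values outside the interval play no role.\<close>

definition deriv_I :: "(real \<Rightarrow> real) \<Rightarrow> real \<Rightarrow> real" where
  "deriv_I f x = vector_derivative f (at x within {0..1})"

primrec Ck_I :: "nat \<Rightarrow> (real \<Rightarrow> real) \<Rightarrow> bool" where
  "Ck_I 0 f \<longleftrightarrow> continuous_on {0..1} f"
| "Ck_I (Suc k) f \<longleftrightarrow> f differentiable_on {0..1} \<and> Ck_I k (deriv_I f)"

definition vorticity :: "(real \<Rightarrow> real) \<Rightarrow> (real \<Rightarrow> real) \<Rightarrow> real \<Rightarrow> real" where
  "vorticity H u x = deriv_I u x / H x"

section \<open>The operator and its real eigenvalues\<close>

text \<open>
  The functions to which \<^term>\<open>abs_L2I\<close> is applied are square integrable as soon as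
  \<^term>\<open>u\<close> and \<^term>\<open>H\<close> are continuous on the closed interval.
\<close>

definition A0 :: "real \<Rightarrow> (real \<Rightarrow> real) \<Rightarrow> (real \<Rightarrow> real) \<Rightarrow> L2I \<times> L2I \<Rightarrow> L2I \<times> L2I" where
  "A0 g H u = (\<lambda>(\<phi>\<^sub>1, \<phi>\<^sub>2).
     (abs_L2I (\<lambda>x. complex_of_real (u x) * rep_L2I \<phi>\<^sub>1 x + complex_of_real (H x) * rep_L2I \<phi>\<^sub>2 x),
      abs_L2I (\<lambda>x. complex_of_real g * (LINT y|unit_measure. rep_L2I \<phi>\<^sub>1 y)
        + complex_of_real (u x) * rep_L2I \<phi>\<^sub>2 x)))"

lemma square_integrable_continuous_mult:
  fixes w :: "real \<Rightarrow> real"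
  assumes w: "continuous_on {0..1} w"
  shows "square_integrable (\<lambda>x. complex_of_real (w x) * rep_L2I \<phi> x)"
proof -
  have "compact (w ` {0..1})"
    using w compact_Icc compact_continuous_image by blast
  then obtain B where B: "\<And>x. x \<in> {0..1} \<Longrightarrow> \<bar>w x\<bar> \<le> B"
    using compact_imp_bounded[of "w ` {0..1}"] unfolding bounded_iff by fastforce
  show ?thesis
  proof (rule square_integrable_bounded_mult)
    show "square_integrable (rep_L2I \<phi>)"
      using l2_eq_rep_L2I by (simp add: l2_eq_def)
    have "continuous_on {0<..<1} (\<lambda>x. complex_of_real (w x))"
      by (intro continuous_intros continuous_on_subset[OF w]) auto
    then show "(\<lambda>x. complex_of_real (w x)) \<in> borel_measurable unit_measure"
      by (rule continuous_imp_measurable_on_sets_lebesgue) auto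
    show "cmod (complex_of_real (w x)) \<le> B" if "x \<in> {0<..<1}" for x
      using B[of x] that by simp
  qed
qed

lemma A0_AE:
  assumes "continuous_on {0..1} H" "continuous_on {0..1} u"
  shows "AE x in unit_measure. rep_L2I (fst (A0 g H u (\<phi>\<^sub>1, \<phi>\<^sub>2))) x
           = complex_of_real (u x) * rep_L2I \<phi>\<^sub>1 x + complex_of_real (H x) * rep_L2I \<phi>\<^sub>2 x"
    and "AE x in unit_measure. rep_L2I (snd (A0 g H u (\<phi>\<^sub>1, \<phi>\<^sub>2))) x
           = complex_of_real g * (LINT y|unit_measure. rep_L2I \<phi>\<^sub>1 y)
             + complex_of_real (u x) * rep_L2I \<phi>\<^sub>2 x"
  unfolding A0_def using assms
  by (auto intro!: rep_abs_L2I_AE square_integrable_add square_integrable_const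
      square_integrable_continuous_mult)

definition depth :: "(real \<Rightarrow> real) \<Rightarrow> real" where
  "depth H = (LINT x|unit_measure. H x)"

definition u_minus :: "(real \<Rightarrow> real) \<Rightarrow> real" where
  "u_minus u = (INF x\<in>{0<..<1}. u x)"

definition u_plus :: "(real \<Rightarrow> real) \<Rightarrow> real" where
  "u_plus u = (SUP x\<in>{0<..<1}. u x)"

definition J_minus :: "real \<Rightarrow> (real \<Rightarrow> real) \<Rightarrow> (real \<Rightarrow> real) \<Rightarrow> real set" where
  "J_minus g H u = {u_minus u - sqrt (g * depth H)..<u_minus u}"

definition J_plus :: "real \<Rightarrow> (real \<Rightarrow> real) \<Rightarrow> (real \<Rightarrow> real) \<Rightarrow> real set" where
  "J_plus g H u = {u_plus u<..u_plus u + sqrt (g * depth H)}"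

definition dispersion :: "real \<Rightarrow> (real \<Rightarrow> real) \<Rightarrow> (real \<Rightarrow> real) \<Rightarrow> real \<Rightarrow> bool" where
  "dispersion g H u c \<longleftrightarrow> (LINT x|unit_measure. g * H x / (c - u x)\<^sup>2) = 1"

definition c_minus :: "real \<Rightarrow> (real \<Rightarrow> real) \<Rightarrow> (real \<Rightarrow> real) \<Rightarrow> real" where
  "c_minus g H u = (THE c. c \<in> J_minus g H u \<and> dispersion g H u c)"

definition c_plus :: "real \<Rightarrow> (real \<Rightarrow> real) \<Rightarrow> (real \<Rightarrow> real) \<Rightarrow> real" where
  "c_plus g H u = (THE c. c \<in> J_plus g H u \<and> dispersion g H u c)"

end

theory Submission
  imports Defs
begin

text \<open>
  For \<open>c \<notin> u[0,1]\<close> the system \<open>(A\<^sub>0 - c) \<phi> = \<psi>\<close> can be solved explicitly up to the scalar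
  \<open>m = \<integral>\<phi>\<^sub>1\<close>, which has to satisfy \<open>(1 - D(c)) m = \<ell>(\<psi>)\<close> with \<open>D(c) = \<integral> g H / (u - c)\<^sup>2\<close> and a bounded
  functional \<open>\<ell>\<close>. So \<open>A\<^sub>0 - c\<close> is invertible if \<open>D(c) \<noteq> 1\<close>; if \<open>D(c) = 1\<close>, its kernel is a line and its
  range is \<open>ker \<ell>\<close>. For \<open>c \<in> u[0,1]\<close> the function \<open>1 / (u - c)\<close> is not square integrable, as \<open>u\<close> is
  Lipschitz; hence \<open>A\<^sub>0 - c\<close> is injective and misses \<open>(0, 1)\<close>, while its range is dense.

  For real \<open>c\<close> below or above \<open>u[0,1]\<close>, \<open>D\<close> is strictly monotone and blows up at the end of the range.
  The vorticity condition excludes non-real roots of \<open>D(c) = 1\<close>. With \<open>u\<close> increasing, \<open>c = a + \<i> b\<close> and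
  \<open>P(y) = (y - u(s)) / \<bar>y - c\<bar>\<^sup>2\<close>, a combination of real and imaginary part of \<open>D(c) = 1\<close> reads
  \<open>\<integral> H P'(u) = - 1 / g\<close>. But \<open>(P(u) / \<omega>)' = H P'(u) - P(u) \<omega>' / \<omega>\<^sup>2 \<le> H P'(u)\<close> if \<open>s\<close> is the point where
  \<open>\<omega>'\<close> changes sign (an endpoint in the first case), and \<open>P(u) / \<omega>\<close> is nonpositive at \<open>0\<close> and
  nonnegative at \<open>1\<close>.
\<close>

section \<open>Multiplication operators, constants and the integral on the square integrable functions\<close>

text \<open>Meaningful only when the product is square integrable, which continuity of
  \<open>w\<close> on \<open>{0..1}\<close> ensures.\<close>

definition mult_op :: "(real \<Rightarrow> complex) \<Rightarrow> L2I \<Rightarrow> L2I" where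
  "mult_op w \<phi> = abs_L2I (\<lambda>x. w x * rep_L2I \<phi> x)"

definition const_L2I :: "complex \<Rightarrow> L2I" where
  "const_L2I k = abs_L2I (\<lambda>x. k)"

definition integral_L2I :: "L2I \<Rightarrow> complex" where
  "integral_L2I \<phi> = (LINT x|unit_measure. rep_L2I \<phi> x)"

lemma square_integrable_rep: "square_integrable (rep_L2I \<phi>)"
  using l2_eq_rep_L2I by (simp add: l2_eq_def)

lemma rep_L2I_measurable [measurable]: "rep_L2I \<phi> \<in> borel_measurable unit_measure"
  using square_integrable_rep by (simp add: square_integrable_def)

text \<open>Reduces identities in \<open>L2I\<close> to almost everywhere identities between chosen
  representatives, which \<open>eventually_elim\<close> then combines pointwise.\<close>

lemma L2I_eq_iff: "\<phi> = \<psi> \<longleftrightarrow> (AE x in unit_measure. rep_L2I \<phi> x = rep_L2I \<psi> x)"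
proof
  assume "AE x in unit_measure. rep_L2I \<phi> x = rep_L2I \<psi> x"
  then have "l2_eq (rep_L2I \<phi>) (rep_L2I \<psi>)"
    by (simp add: l2_eq_def square_integrable_rep)
  then show "\<phi> = \<psi>"
    using Quotient_rel_abs[OF Quotient_L2I] by (metis Quotient_L2I Quotient_abs_rep)
qed simp

lemma abs_rep_L2I: "abs_L2I (rep_L2I \<phi>) = \<phi>"
  by (metis Quotient_L2I Quotient_abs_rep)

lemma abs_L2I_add:
  assumes "square_integrable f" "square_integrable h"
  shows "abs_L2I (\<lambda>x. f x + h x) = abs_L2I f + abs_L2I h"
  using plus_L2I.abs_eq[of f h] assms by (simp add: l2_eq_def)

lemma rep_L2I_add: "AE x in unit_measure. rep_L2I (\<phi> + \<psi>) x = rep_L2I \<phi> x + rep_L2I \<psi> x"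
proof -
  have "\<phi> + \<psi> = abs_L2I (\<lambda>x. rep_L2I \<phi> x + rep_L2I \<psi> x)"
    using plus_L2I.abs_eq[OF l2_eq_rep_L2I l2_eq_rep_L2I, of \<phi> \<psi>] by (simp add: abs_rep_L2I)
  then show ?thesis
    using rep_abs_L2I_AE[OF square_integrable_add[OF square_integrable_rep square_integrable_rep]]
    by metis
qed

lemma rep_L2I_scaleC: "AE x in unit_measure. rep_L2I (scaleC a \<phi>) x = a * rep_L2I \<phi> x"
proof -
  have "scaleC a \<phi> = abs_L2I (\<lambda>x. a * rep_L2I \<phi> x)"
    using scaleC_L2I.abs_eq[OF l2_eq_rep_L2I, of a \<phi>] by (simp add: abs_rep_L2I)
  then show ?thesis
    using rep_abs_L2I_AE[OF square_integrable_mult_left[OF square_integrable_rep]] by metis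
qed

lemma rep_L2I_zero: "AE x in unit_measure. rep_L2I 0 x = 0"
  using rep_L2I_scaleC[of 0 0] by simp

lemma rep_L2I_const: "AE x in unit_measure. rep_L2I (const_L2I k) x = k"
  unfolding const_L2I_def by (rule rep_abs_L2I_AE[OF square_integrable_const])

lemma norm_L2I_rep: "(norm \<phi>)\<^sup>2 = (LINT x|unit_measure. (cmod (rep_L2I \<phi> x))\<^sup>2)"
  using norm_L2I_abs[OF square_integrable_rep, of \<phi>] by (simp add: abs_rep_L2I)

lemma integrable_rep_sq: "integrable unit_measure (\<lambda>x. (cmod (rep_L2I \<phi> x))\<^sup>2)"
  using square_integrable_rep by (simp add: square_integrable_def)

section \<open>Multiplication by continuous functions\<close>

lemma square_integrable_continuous:
  fixes w :: "real \<Rightarrow> complex"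
  assumes "continuous_on {0..1} w" and f: "square_integrable f"
  shows "square_integrable (\<lambda>x. w x * f x)"
proof -
  obtain B where B: "\<And>x. x \<in> {0..1} \<Longrightarrow> cmod (w x) \<le> B"
    using compact_imp_bounded[OF compact_continuous_image[OF assms(1)]]
    unfolding bounded_iff by fastforce
  have "w \<in> borel_measurable unit_measure"
    by (intro continuous_imp_measurable_on_sets_lebesgue continuous_on_subset[OF assms(1)]) auto
  then show ?thesis
    by (rule square_integrable_bounded_mult[OF f, of w B]) (auto intro: B)
qed

lemma rep_mult_op:
  assumes "continuous_on {0..1} w"
  shows "AE x in unit_measure. rep_L2I (mult_op w \<phi>) x = w x * rep_L2I \<phi> x"
  unfolding mult_op_def
  by (rule rep_abs_L2I_AE[OF square_integrable_continuous[OF assms square_integrable_rep]])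

lemma mult_op_mult_op:
  assumes "continuous_on {0..1} w" "continuous_on {0..1} v"
  shows "mult_op w (mult_op v \<phi>) = mult_op (\<lambda>x. w x * v x) \<phi>"
proof -
  have "continuous_on {0..1} (\<lambda>x. w x * v x)" using assms by (intro continuous_intros)
  then show ?thesis
    unfolding L2I_eq_iff
    using rep_mult_op[OF assms(1), of "mult_op v \<phi>"] rep_mult_op[OF assms(2), of \<phi>]
      rep_mult_op[of "\<lambda>x. w x * v x" \<phi>]
    by (auto elim!: AE_mp)
qed

lemma mult_op_cong:
  assumes "\<And>x. x \<in> {0..1} \<Longrightarrow> w x = v x" "continuous_on {0..1} v"
  shows "mult_op w \<phi> = mult_op v \<phi>"
proof -
  have w: "continuous_on {0..1} w" using assms continuous_on_cong by metis
  have eq: "AE x in unit_measure. w x = v x"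
    by (rule AE_I2) (auto intro: assms)
  show ?thesis
    unfolding L2I_eq_iff using eq rep_mult_op[OF w, of \<phi>] rep_mult_op[OF assms(2), of \<phi>]
    by (auto elim!: AE_mp)
qed

lemma mult_op_one: "mult_op (\<lambda>x. 1) \<phi> = \<phi>"
  by (simp add: mult_op_def abs_rep_L2I)

lemma mult_op_add:
  assumes "continuous_on {0..1} w"
  shows "mult_op w (\<phi> + \<psi>) = mult_op w \<phi> + mult_op w \<psi>"
  unfolding L2I_eq_iff
  using rep_mult_op[OF assms, of \<phi>] rep_mult_op[OF assms, of \<psi>] rep_mult_op[OF assms, of "\<phi> + \<psi>"]
    rep_L2I_add[of \<phi> \<psi>] rep_L2I_add[of "mult_op w \<phi>" "mult_op w \<psi>"]
  by eventually_elim (simp add: distrib_left)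

lemma mult_op_scaleC:
  assumes "continuous_on {0..1} w"
  shows "mult_op w (scaleC a \<phi>) = scaleC a (mult_op w \<phi>)"
  unfolding L2I_eq_iff
  using rep_mult_op[OF assms, of \<phi>] rep_mult_op[OF assms, of "scaleC a \<phi>"]
    rep_L2I_scaleC[of a \<phi>] rep_L2I_scaleC[of a "mult_op w \<phi>"]
  by eventually_elim simp

lemma mult_op_diff_const:
  assumes "continuous_on {0..1} w"
  shows "mult_op (\<lambda>x. w x - c) \<phi> = mult_op w \<phi> - scaleC c \<phi>"
proof -
  have c: "continuous_on {0..1} (\<lambda>x. w x - c)" using assms by (intro continuous_intros)
  have "mult_op (\<lambda>x. w x - c) \<phi> + scaleC c \<phi> = mult_op w \<phi>"
    unfolding L2I_eq_iff
    using rep_mult_op[OF assms, of \<phi>] rep_mult_op[OF c, of \<phi>]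
      rep_L2I_scaleC[of c \<phi>] rep_L2I_add[of "mult_op (\<lambda>x. w x - c) \<phi>" "scaleC c \<phi>"]
    by eventually_elim (simp add: algebra_simps)
  then show ?thesis by (metis add_diff_cancel_right')
qed

lemma norm_mult_op:
  assumes "continuous_on {0..1} w"
  shows "(norm (mult_op w \<phi>))\<^sup>2 = (LINT x|unit_measure. (cmod (w x) * cmod (rep_L2I \<phi> x))\<^sup>2)"
  unfolding mult_op_def
  using norm_L2I_abs[OF square_integrable_continuous[OF assms square_integrable_rep], of \<phi>]
  by (simp add: norm_mult)

lemma norm_mult_op_le:
  assumes "continuous_on {0..1} w" "\<And>x. x \<in> {0..1} \<Longrightarrow> cmod (w x) \<le> B"
  shows "norm (mult_op w \<phi>) \<le> B * norm \<phi>"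
proof -
  have B: "0 \<le> B" using order_trans[OF norm_ge_zero assms(2)[of 0]] by simp
  have "(norm (mult_op w \<phi>))\<^sup>2 \<le> (LINT x|unit_measure. B\<^sup>2 * (cmod (rep_L2I \<phi> x))\<^sup>2)"
    unfolding norm_mult_op[OF assms(1)]
  proof (rule integral_mono_AE)
    show "integrable unit_measure (\<lambda>x. (cmod (w x) * cmod (rep_L2I \<phi> x))\<^sup>2)"
      using square_integrable_continuous[OF assms(1) square_integrable_rep, of \<phi>]
      by (simp add: square_integrable_def norm_mult)
    show "integrable unit_measure (\<lambda>x. B\<^sup>2 * (cmod (rep_L2I \<phi> x))\<^sup>2)"
      using integrable_rep_sq by simp
    show "AE x in unit_measure. (cmod (w x) * cmod (rep_L2I \<phi> x))\<^sup>2 \<le> B\<^sup>2 * (cmod (rep_L2I \<phi> x))\<^sup>2"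
      by (rule AE_I2) (auto simp: power_mult_distrib intro!: mult_right_mono power_mono assms)
  qed
  also have "\<dots> = (B * norm \<phi>)\<^sup>2"
    by (simp add: power_mult_distrib norm_L2I_rep)
  finally show ?thesis
    using B by (simp add: power2_le_iff_abs_le)
qed

lemma bounded_linear_mult_op:
  assumes "continuous_on {0..1} w"
  shows "bounded_linear (mult_op w)"
proof -
  obtain B where "\<And>x. x \<in> {0..1} \<Longrightarrow> cmod (w x) \<le> B"
    using compact_imp_bounded[OF compact_continuous_image[OF assms(1)]]
    unfolding bounded_iff by fastforce
  then have "norm (mult_op w \<phi>) \<le> norm \<phi> * B" for \<phi>
    using norm_mult_op_le[OF assms, of B \<phi>] by (simp add: mult.commute)
  then show ?thesis
    by (intro bounded_linear_intro[of _ B])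
      (auto simp: mult_op_add mult_op_scaleC assms scaleR_eq_scaleC)
qed

section \<open>The integral and the constant functions\<close>

lemma integrable_rep: "integrable unit_measure (rep_L2I \<phi>)"
proof (rule Bochner_Integration.integrable_bound)
  \<comment> \<open>The interval has finite measure, so this majorant is integrable; it dominates
    the modulus because \<open>2 * t \<le> 1 + t\<^sup>2\<close>.\<close>
  show "integrable unit_measure (\<lambda>x. 1 + (cmod (rep_L2I \<phi> x))\<^sup>2)"
    using square_integrable_const[of 1] integrable_rep_sq[of \<phi>] by (simp add: square_integrable_def)
  show "AE x in unit_measure. norm (rep_L2I \<phi> x) \<le> norm (1 + (cmod (rep_L2I \<phi> x))\<^sup>2)"
  proof (rule AE_I2)
    fix x
    have "0 \<le> (cmod (rep_L2I \<phi> x) - 1)\<^sup>2" by simp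
    then have "2 * cmod (rep_L2I \<phi> x) \<le> 1 + (cmod (rep_L2I \<phi> x))\<^sup>2"
      by (simp add: power2_diff)
    moreover have "0 \<le> cmod (rep_L2I \<phi> x)" by simp
    ultimately show "norm (rep_L2I \<phi> x) \<le> norm (1 + (cmod (rep_L2I \<phi> x))\<^sup>2)"
      unfolding real_norm_def by linarith
  qed
qed simp

text \<open>Makes Cauchy-Schwarz available for the integral.\<close>

lemma inner_const_L2I: "\<phi> \<bullet> const_L2I k = integral_L2I \<phi> \<bullet> k"
proof -
  have "\<phi> \<bullet> const_L2I k = (LINT x|unit_measure. rep_L2I \<phi> x \<bullet> k)"
    using inner_L2I.abs_eq[OF l2_eq_rep_L2I, of "\<lambda>x. k" \<phi>] square_integrable_const[of k]
    by (simp add: abs_rep_L2I const_L2I_def l2_eq_def)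
  also have "\<dots> = integral_L2I \<phi> \<bullet> k"
    by (simp add: integral_L2I_def integral_inner_left integrable_rep)
  finally show ?thesis .
qed

lemma integral_L2I_add: "integral_L2I (\<phi> + \<psi>) = integral_L2I \<phi> + integral_L2I \<psi>"
  unfolding integral_L2I_def Bochner_Integration.integral_add[OF integrable_rep integrable_rep, symmetric]
  by (rule integral_cong_AE[OF _ _ rep_L2I_add]) measurable

lemma integral_L2I_scaleC: "integral_L2I (scaleC a \<phi>) = a * integral_L2I \<phi>"
  unfolding integral_L2I_def integral_mult_right_zero[symmetric]
  by (rule integral_cong_AE[OF _ _ rep_L2I_scaleC]) measurable

lemma norm_const_L2I: "norm (const_L2I k) = cmod k"
  unfolding const_L2I_def norm_L2I_abs[OF square_integrable_const]
  by (simp add: measure_restrict_space)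

text \<open>Cauchy-Schwarz against the constant function whose value is
  \<open>integral_L2I \<phi>\<close>; its norm is the modulus of that value, as the interval has
  measure 1.\<close>

lemma norm_integral_L2I_le: "cmod (integral_L2I \<phi>) \<le> norm \<phi>"
proof (cases "integral_L2I \<phi> = 0")
  case False
  have "(cmod (integral_L2I \<phi>))\<^sup>2 \<le> norm \<phi> * cmod (integral_L2I \<phi>)"
    using norm_cauchy_schwarz[of \<phi> "const_L2I (integral_L2I \<phi>)"]
    by (simp add: inner_const_L2I norm_const_L2I power2_norm_eq_inner)
  then show ?thesis using False by (simp add: power2_eq_square)
qed simp

lemma bounded_linear_integral_L2I: "bounded_linear integral_L2I"
  by (rule bounded_linear_intro[of _ 1])
    (auto simp: integral_L2I_add integral_L2I_scaleC scaleR_eq_scaleC norm_integral_L2I_le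
      scaleR_conv_of_real)

lemma const_L2I_add: "const_L2I (a + b) = const_L2I a + const_L2I b"
  unfolding L2I_eq_iff using rep_L2I_add[of "const_L2I a" "const_L2I b"]
    rep_L2I_const[of a] rep_L2I_const[of b] rep_L2I_const[of "a + b"]
  by eventually_elim simp

lemma const_L2I_mult: "const_L2I (a * b) = scaleC a (const_L2I b)"
  unfolding L2I_eq_iff using rep_L2I_scaleC[of a "const_L2I b"] rep_L2I_const[of b]
    rep_L2I_const[of "a * b"]
  by eventually_elim simp

lemma bounded_linear_const_L2I: "bounded_linear const_L2I"
  by (rule bounded_linear_intro[of _ 1])
    (auto simp: const_L2I_add const_L2I_mult norm_const_L2I scaleR_conv_of_real scaleR_eq_scaleC)

lemma integral_mult_op_const:
  assumes "continuous_on {0..1} w"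
  shows "integral_L2I (mult_op w (const_L2I k)) = (LINT x|unit_measure. w x) * k"
proof -
  have [measurable]: "w \<in> borel_measurable unit_measure"
    by (intro continuous_imp_measurable_on_sets_lebesgue continuous_on_subset[OF assms(1)]) auto
  show ?thesis
    unfolding integral_L2I_def integral_mult_left_zero[symmetric]
  proof (rule integral_cong_AE)
    show "AE x in unit_measure. rep_L2I (mult_op w (const_L2I k)) x = w x * k"
      using rep_mult_op[OF assms, of "const_L2I k"] rep_L2I_const[of k]
      by eventually_elim simp
  qed measurable
qed

section \<open>The dispersion relation\<close>

text \<open>Bridge from the Lebesgue integral over the open interval, in which the operator and the
  dispersion relation are defined, to the gauge integral over the closed one, where the calculus
  takes place.\<close>

lemma unit_measure_continuous:
  fixes f :: "real \<Rightarrow> 'a::euclidean_space"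
  assumes "continuous_on {0..1} f"
  shows "integrable unit_measure f" "(LINT x|unit_measure. f x) = integral {0..1} f"
proof -
  have "integrable (lebesgue_on {0..1}) f"
    using assms by (rule continuous_imp_integrable_real)
  then have "integrable lebesgue (\<lambda>x. indicator {0..1} x *\<^sub>R f x)"
    by (rule iffD1[OF integrable_restrict_space, rotated]) simp
  then have "integrable lebesgue (\<lambda>x. indicator {0<..<1} x *\<^sub>R indicator {0..1} x *\<^sub>R f x)"
    by (rule integrable_mult_indicator[rotated]) simp
  also have "(\<lambda>x. indicator {0<..<1} x *\<^sub>R indicator {0..1} x *\<^sub>R f x)
      = (\<lambda>x. indicator {0<..<1::real} x *\<^sub>R f x)"
    by (auto simp: indicator_def)
  finally show int: "integrable unit_measure f"
    by (rule iffD2[OF integrable_restrict_space, rotated]) simp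
  show "(LINT x|unit_measure. f x) = integral {0..1} f"
    using lebesgue_integral_eq_integral[OF int] by (simp add: integral_open_interval_real)
qed

section \<open>Real roots of the dispersion relation\<close>

lemma integral_positive:
  fixes f :: "real \<Rightarrow> real"
  assumes "continuous_on {0..1} f" "\<And>x. x \<in> {0..1} \<Longrightarrow> f x > 0"
  shows "integral {0..1} f > 0"
proof -
  obtain z where z: "z \<in> {0..1}" "\<And>x. x \<in> {0..1} \<Longrightarrow> f z \<le> f x"
    using continuous_attains_inf[OF compact_Icc _ assms(1)] by fastforce
  have "integral {0..1::real} (\<lambda>x. f z) \<le> integral {0..1} f"
    by (intro integral_le integrable_continuous_real assms z) auto
  with assms(2)[OF z(1)] show ?thesis by simp
qed

text \<open>On an interval of length \<open>e\<close> ending at \<open>p\<close> the integrand is at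
  least \<open>1 / ((L\<^sup>2 + 1) * e\<^sup>2)\<close>. The blow-up as \<open>e\<close> tends to 0
  serves twice: for the dispersion integral at the end of the range of \<open>u\<close>, and for the
  failure of \<open>1 / (u - u p)\<close> to be square integrable.\<close>

lemma integral_inverse_square_ge:
  fixes w :: "real \<Rightarrow> real"
  assumes w: "continuous_on {0..1} w" and p: "p \<in> {0..1}"
    and L: "\<And>x. x \<in> {0..1} \<Longrightarrow> \<bar>w x\<bar> \<le> L * \<bar>x - p\<bar>"
    and e: "0 < e" "e \<le> 1/2"
  shows "1 / ((L\<^sup>2 + 1) * e) \<le> integral {0..1} (\<lambda>x. 1 / ((w x)\<^sup>2 + e\<^sup>2))"
proof -
  \<comment> \<open>The interval starts or ends at \<open>p\<close>, whichever keeps it inside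
    \<open>{0..1}\<close>; \<open>e \<le> 1/2\<close> makes this possible.\<close>
  define a where "a = (if p \<le> 1/2 then p else p - e)"
  have a: "{a..a+e} \<subseteq> {0..1}" "\<And>x. x \<in> {a..a+e} \<Longrightarrow> \<bar>x - p\<bar> \<le> e"
    using p e by (auto simp: a_def split: if_splits)
  have nz: "(w x)\<^sup>2 + e\<^sup>2 > 0" for x
    using e by (simp add: add_nonneg_pos)
  have cont: "continuous_on {0..1} (\<lambda>x. 1 / ((w x)\<^sup>2 + e\<^sup>2))"
    using nz by (intro continuous_intros w) (metis less_irrefl)
  have contK: "continuous_on {a..a+e} (\<lambda>x. 1 / ((w x)\<^sup>2 + e\<^sup>2))"
    using cont a continuous_on_subset by blast
  have "1 / ((L\<^sup>2 + 1) * e) = integral {a..a+e} (\<lambda>x. 1 / ((L\<^sup>2 + 1) * e\<^sup>2))"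
    using e by (simp add: power2_eq_square)
  also have "\<dots> \<le> integral {a..a+e} (\<lambda>x. 1 / ((w x)\<^sup>2 + e\<^sup>2))"
  proof (intro integral_le integrable_continuous_real contK)
    fix x assume x: "x \<in> {a..a+e}"
    have "\<bar>w x\<bar> \<le> \<bar>L\<bar> * \<bar>x - p\<bar>"
      using L[of x] a x by (metis abs_ge_self abs_ge_zero mult_right_mono order_trans subsetD)
    also have "\<dots> \<le> \<bar>L\<bar> * e"
      using a(2)[OF x] by (intro mult_left_mono) auto
    finally have "(w x)\<^sup>2 \<le> (\<bar>L\<bar> * e)\<^sup>2"
      using power_mono[of "\<bar>w x\<bar>" "\<bar>L\<bar> * e" 2] by simp
    then have "(w x)\<^sup>2 + e\<^sup>2 \<le> (L\<^sup>2 + 1) * e\<^sup>2"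
      by (simp add: power_mult_distrib algebra_simps)
    then show "1 / ((L\<^sup>2 + 1) * e\<^sup>2) \<le> 1 / ((w x)\<^sup>2 + e\<^sup>2)"
      using nz[of x] e by (intro divide_left_mono mult_pos_pos) (auto simp: add_nonneg_pos)
  qed auto
  also have "\<dots> \<le> integral {0..1} (\<lambda>x. 1 / ((w x)\<^sup>2 + e\<^sup>2))"
    using a(1) by (intro integral_subset_le integrable_continuous_real cont contK) auto
  finally show ?thesis .
qed

text \<open>Below the minimum of \<open>u\<close>, \<open>D\<close> is strictly increasing, since
  every distance to \<open>u x\<close> shrinks. It is at most 1 at the left end of the interval and
  at least 1 close to \<open>u p\<close>, so the intermediate value theorem gives a root, and
  monotonicity makes it unique on the whole half-line.\<close>

lemma dispersion_root:
  fixes H u :: "real \<Rightarrow> real" and g :: real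
  assumes g: "g > 0" and H: "continuous_on {0..1} H" "\<And>x. x \<in> {0..1} \<Longrightarrow> H x > 0"
    and u: "continuous_on {0..1} u" and p: "p \<in> {0..1}"
    and min: "\<And>x. x \<in> {0..1} \<Longrightarrow> u p \<le> u x"
    and L: "\<And>x. x \<in> {0..1} \<Longrightarrow> \<bar>u x - u p\<bar> \<le> L * \<bar>x - p\<bar>"
  defines "D \<equiv> \<lambda>c. integral {0..1} (\<lambda>x. g * H x / (c - u x)\<^sup>2)"
  shows "\<exists>c\<in>{u p - sqrt (g * integral {0..1} H)..<u p}. D c = 1 \<and> (\<forall>c'<u p. D c' = 1 \<longrightarrow> c' = c)"
proof -
  define h where "h = integral {0..1} H"
  have h: "h > 0" unfolding h_def using H by (rule integral_positive)
  \<comment> \<open>At \<open>c0\<close> all distances to \<open>u x\<close> are at least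
    \<open>sqrt (g * h)\<close>, so the integrand is at most \<open>H x / h\<close>, which has
    integral 1.\<close>
  define c0 where "c0 = u p - sqrt (g * h)"
  have c0: "c0 < u p" using g h by (simp add: c0_def)
  have cont: "continuous_on {0..1} (\<lambda>x. g * H x / (c - u x)\<^sup>2)" if "c < u p" for c
    using min that by (intro continuous_intros H u) fastforce+
  have mono: "D a < D b" if ab: "a < b" "b < u p" for a b
  proof -
    have "0 < integral {0..1} (\<lambda>x. g * H x / (b - u x)\<^sup>2 - g * H x / (a - u x)\<^sup>2)"
    proof (rule integral_positive)
      show "continuous_on {0..1} (\<lambda>x. g * H x / (b - u x)\<^sup>2 - g * H x / (a - u x)\<^sup>2)"
        using ab by (intro continuous_on_diff cont) auto
      fix x :: real assume x: "x \<in> {0..1}"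
      have "0 < u x - b" "u x - b < u x - a" using min[OF x] ab by auto
      then have "(u x - b)\<^sup>2 < (u x - a)\<^sup>2" "0 < (u x - b)\<^sup>2"
        by (auto intro!: power_strict_mono)
      then have "g * H x / (u x - a)\<^sup>2 < g * H x / (u x - b)\<^sup>2"
        using g H(2)[OF x] by (intro divide_strict_left_mono mult_pos_pos) auto
      then show "0 < g * H x / (b - u x)\<^sup>2 - g * H x / (a - u x)\<^sup>2"
        by (simp add: power2_commute)
    qed
    also have "\<dots> = D b - D a"
      unfolding D_def using ab by (intro integral_diff integrable_continuous_real cont) auto
    finally show ?thesis by simp
  qed
  have "D c0 \<le> integral {0..1} (\<lambda>x. g * H x / (g * h))"
    unfolding D_def
  proof (rule integral_le)
    show "(\<lambda>x. g * H x / (c0 - u x)\<^sup>2) integrable_on {0..1}"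
      using cont[OF c0] by (rule integrable_continuous_real)
    show "(\<lambda>x. g * H x / (g * h)) integrable_on {0..1}"
      using g h by (intro integrable_continuous_real continuous_intros H) auto
    fix x :: real assume x: "x \<in> {0..1}"
    have "(sqrt (g * h))\<^sup>2 \<le> (u x - c0)\<^sup>2"
      using min[OF x] g h by (intro power_mono) (auto simp: c0_def)
    then have "g * h \<le> (c0 - u x)\<^sup>2" using g h by (simp add: power2_commute)
    moreover have "0 < g * h" "0 \<le> g * H x" using g h H(2)[OF x] by simp_all
    ultimately show "g * H x / (c0 - u x)\<^sup>2 \<le> g * H x / (g * h)"
      by (intro divide_left_mono mult_pos_pos[of "(c0 - u x)\<^sup>2" "g * h"]) linarith+
  qed
  also have "\<dots> = 1"
    using g h by (simp add: h_def integral_divide)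
  finally have low: "D c0 \<le> 1" .
  obtain z where z: "z \<in> {0..1}" "\<And>x. x \<in> {0..1} \<Longrightarrow> H z \<le> H x"
    using continuous_attains_inf[OF compact_Icc _ H(1)] by fastforce
  \<comment> \<open>Chosen so that \<open>k / e\<close> bounds \<open>D (u p - e)\<close> from
    below: \<open>H z\<close> is the minimum of \<open>H\<close>, and the factor 2 comes from
    \<open>(y + e)\<^sup>2 \<le> 2 * (y\<^sup>2 + e\<^sup>2)\<close> with
    \<open>y = u x - u p\<close>.\<close>
  define k where "k = g * H z / (2 * (L\<^sup>2 + 1))"
  have L1: "L\<^sup>2 + 1 > 0" by (simp add: add_nonneg_pos)
  have k: "k > 0" using g H(2)[OF z(1)] L1 by (simp add: k_def)
  \<comment> \<open>The three bounds serve the estimate of the integral, the inequality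
    \<open>1 \<le> k / e\<close>, and the position of \<open>u p - e\<close> to the right of
    \<open>c0\<close>.\<close>
  define e where "e = min (1/2) (min k (u p - c0))"
  have e: "0 < e" "e \<le> 1/2" "e \<le> k" "c0 \<le> u p - e"
    using k c0 unfolding e_def by linarith+
  have "1 \<le> k / e" using e by simp
  also have "k / e = g * H z / 2 * (1 / ((L\<^sup>2 + 1) * e))" by (simp add: k_def)
  also have "\<dots> \<le> g * H z / 2 * integral {0..1} (\<lambda>x. 1 / ((u x - u p)\<^sup>2 + e\<^sup>2))"
    using e g H(2)[OF z(1)] L p
    by (intro mult_left_mono integral_inverse_square_ge continuous_intros u) auto
  also have "\<dots> = integral {0..1} (\<lambda>x. g * H z / 2 * (1 / ((u x - u p)\<^sup>2 + e\<^sup>2)))"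
    by (rule integral_mult_right[symmetric])
  also have "\<dots> \<le> D (u p - e)"
    unfolding D_def
  proof (rule integral_le)
    have nz: "(u x - u p)\<^sup>2 + e\<^sup>2 > 0" for x
      using e by (simp add: add_nonneg_pos)
    show "(\<lambda>x. g * H z / 2 * (1 / ((u x - u p)\<^sup>2 + e\<^sup>2))) integrable_on {0..1}"
      using nz by (intro integrable_continuous_real continuous_intros u) (metis less_irrefl)
    show "(\<lambda>x. g * H x / (u p - e - u x)\<^sup>2) integrable_on {0..1}"
      using e by (intro integrable_continuous_real cont) auto
    fix x :: real assume x: "x \<in> {0..1}"
    have "0 \<le> ((u x - u p) - e)\<^sup>2" by simp
    then have "(u p - e - u x)\<^sup>2 \<le> 2 * ((u x - u p)\<^sup>2 + e\<^sup>2)"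
      by (simp add: power2_eq_square algebra_simps)
    moreover have "0 < (u p - e - u x)\<^sup>2" using min[OF x] e by auto
    ultimately have "g * H z / (2 * ((u x - u p)\<^sup>2 + e\<^sup>2)) \<le> g * H z / (u p - e - u x)\<^sup>2"
      using g H(2)[OF z(1)] nz[of x] by (intro divide_left_mono) auto
    also have "\<dots> \<le> g * H x / (u p - e - u x)\<^sup>2"
      using g z(2)[OF x] by (intro divide_right_mono mult_left_mono) auto
    finally show "g * H z / 2 * (1 / ((u x - u p)\<^sup>2 + e\<^sup>2)) \<le> g * H x / (u p - e - u x)\<^sup>2"
      by simp
  qed
  finally have high: "1 \<le> D (u p - e)" .
  have "continuous_on {c0..u p - e} D"
  proof -
    have "continuous_on ({c0..u p - e} \<times> cbox 0 1) (\<lambda>(c, x). g * H x / (c - u x)\<^sup>2)"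
      unfolding split_beta
    proof (intro continuous_intros continuous_on_compose2[OF H(1)] continuous_on_compose2[OF u])
      show "\<forall>z\<in>{c0..u p - e} \<times> cbox 0 1. (fst z - u (snd z))\<^sup>2 \<noteq> 0"
        using min e by fastforce
    qed auto
    from integral_continuous_on_param[OF this] show ?thesis
      by (simp add: D_def)
  qed
  then obtain c where c: "c0 \<le> c" "c \<le> u p - e" "D c = 1"
    using IVT'[of D c0 1 "u p - e"] low high e by blast
  show ?thesis
  proof (intro bexI conjI allI impI)
    show "c \<in> {u p - sqrt (g * integral {0..1} H)..<u p}"
      using c e by (auto simp: c0_def h_def)
    fix c' assume "c' < u p" "D c' = 1"
    then show "c' = c"
      using mono[of c c'] mono[of c' c] c e by (cases c c' rule: linorder_cases) auto
  qed (rule c)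
qed

section \<open>Exclusion of non-real roots\<close>

text \<open>
  The fraction is the derivative of \<open>P(y) = (y - u s) / \<bar>y - (a + \<i> b)\<bar>\<^sup>2\<close> at \<open>y = u x\<close>.
\<close>

lemma rayleigh_integral_nonneg:
  fixes H u \<omega> \<omega>' :: "real \<Rightarrow> real"
  assumes H: "continuous_on {0..1} H" "\<And>x. x \<in> {0..1} \<Longrightarrow> H x > 0"
    and u: "\<And>x. x \<in> {0..1} \<Longrightarrow> (u has_real_derivative H x * \<omega> x) (at x within {0..1})"
    and \<omega>: "\<And>x. x \<in> {0..1} \<Longrightarrow> (\<omega> has_real_derivative \<omega>' x) (at x within {0..1})"
    and nonneg: "\<And>x. x \<in> {0..1} \<Longrightarrow> \<omega> x \<ge> 0"
    and s: "s \<in> {0..1}" and sgn: "\<And>x. x \<in> {0..1} - {s} \<Longrightarrow> \<omega>' x * (x - s) > 0"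
    and b: "b \<noteq> 0"
  shows "0 \<le> integral {0..1} (\<lambda>x. H x *
    (((u x - a)\<^sup>2 + b\<^sup>2 - 2 * (u x - u s) * (u x - a)) / ((u x - a)\<^sup>2 + b\<^sup>2)\<^sup>2))"
proof -
  define N where "N = (\<lambda>x. (u x - a)\<^sup>2 + b\<^sup>2)"
  have N: "N x > 0" "N x \<ge> b\<^sup>2" for x
    using b by (auto simp: N_def add_nonneg_pos)
  \<comment> \<open>In terms of \<open>P\<close>, \<open>f\<close> is \<open>H * P'(u)\<close> and
    \<open>q\<close> is \<open>P(u) / \<omega>\<close>.\<close>
  define f where "f = (\<lambda>x. H x * ((N x - 2 * (u x - u s) * (u x - a)) / (N x)\<^sup>2))"
  define q where "q = (\<lambda>x. (u x - u s) / N x / \<omega> x)"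
  have at: "at x within {0..1} = at x" if "0 < x" "x < 1" for x :: real
    using that by (simp add: at_within_Icc_at)
  have cu: "continuous_on {0..1} u" and c\<omega>: "continuous_on {0..1} \<omega>"
    using DERIV_continuous_on[OF u] DERIV_continuous_on[OF \<omega>] by auto
  have cN: "continuous_on {0..1} N" unfolding N_def by (intro continuous_intros cu)
  have cf: "continuous_on {0..1} f"
    unfolding f_def using N by (intro continuous_intros H cu cN) (metis less_irrefl power_eq_0_iff)
  obtain B where B: "\<And>x. x \<in> {0..1} \<Longrightarrow> H x \<le> B"
    using continuous_attains_sup[OF compact_Icc _ H(1)] by fastforce
  \<comment> \<open>\<open>\<omega>\<close> decreases up to \<open>s\<close> and increases after it.
    Hence it is positive off \<open>s\<close>, though it may vanish at \<open>s\<close>.\<close>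
  have right: "\<omega> x < \<omega> y" if "s \<le> x" "x < y" "y \<le> 1" for x y
  proof (rule DERIV_pos_imp_increasing_open[OF that(2)])
    show "continuous_on {x..y} \<omega>" using that s by (intro continuous_on_subset[OF c\<omega>]) auto
    fix t assume t: "x < t" "t < y"
    then have "(\<omega> has_real_derivative \<omega>' t) (at t)"
      using \<omega>[of t] at[of t] that s by auto
    moreover have "\<omega>' t > 0"
      using sgn[of t] t that s by (auto simp: zero_less_mult_iff)
    ultimately show "\<exists>d. (\<omega> has_real_derivative d) (at t) \<and> d > 0" by blast
  qed
  have left: "\<omega> y < \<omega> x" if "0 \<le> x" "x < y" "y \<le> s" for x y
  proof (rule DERIV_neg_imp_decreasing_open[OF that(2)])
    show "continuous_on {x..y} \<omega>" using that s by (intro continuous_on_subset[OF c\<omega>]) auto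
    fix t assume t: "x < t" "t < y"
    then have "(\<omega> has_real_derivative \<omega>' t) (at t)"
      using \<omega>[of t] at[of t] that s by auto
    moreover have "\<omega>' t < 0"
      using sgn[of t] t that s by (auto simp: zero_less_mult_iff)
    ultimately show "\<exists>d. (\<omega> has_real_derivative d) (at t) \<and> d < 0" by blast
  qed
  have pos: "\<omega> x > 0" if "x \<in> {0..1} - {s}" for x
    using right[of s x] left[of x s] nonneg[of s] s that by (cases "x < s") auto
  have mvt: "\<exists>z. x < z \<and> z < y \<and> u y - u x = (y - x) * (H z * \<omega> z)"
    if "0 \<le> x" "x < y" "y \<le> 1" for x y
  proof -
    have "\<exists>l z. x < z \<and> z < y \<and> (u has_real_derivative l) (at z) \<and> u y - u x = (y - x) * l"
    proof (rule MVT[OF that(2)])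
      show "continuous_on {x..y} u" using that by (intro continuous_on_subset[OF cu]) auto
      fix t assume "x < t" "t < y"
      then show "u differentiable at t"
        using u[of t] at[of t] that by (auto simp: real_differentiable_def)
    qed
    then obtain l z where z: "x < z" "z < y" "(u has_real_derivative l) (at z)" "u y - u x = (y - x) * l"
      by blast
    moreover have "(u has_real_derivative H z * \<omega> z) (at z)"
      using u[of z] at[of z] z that by auto
    ultimately show ?thesis using DERIV_unique by blast
  qed
  \<comment> \<open>The mean value point \<open>z\<close> lies between \<open>x\<close> and
    \<open>s\<close>, where \<open>\<omega> z \<le> \<omega> x\<close>. The factor
    \<open>\<omega> x\<close> gained in this way compensates for the division by
    \<open>\<omega>\<close> in \<open>q\<close>.\<close>
  have bound: "\<bar>u x - u s\<bar> \<le> B * \<omega> x * \<bar>x - s\<bar> \<and> 0 \<le> (u x - u s) * (x - s)"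
    if x: "x \<in> {0..1}" for x
  proof (cases x s rule: linorder_cases)
    case less
    obtain z where z: "x < z" "z < s" "u s - u x = (s - x) * (H z * \<omega> z)"
      using mvt[of x s] less s x by auto
    have Hz: "0 < H z" "H z \<le> B" "0 \<le> \<omega> z" "\<omega> z \<le> \<omega> x"
      using H(2)[of z] B[of z] nonneg[of z] left[of x z] z s x by auto
    then have *: "0 \<le> H z * \<omega> z" "H z * \<omega> z \<le> B * \<omega> x" by (auto intro: mult_mono)
    have "0 \<le> u s - u x" "u s - u x \<le> (s - x) * (B * \<omega> x)"
      unfolding z(3) using * less by (auto intro!: mult_left_mono)
    then show ?thesis using less by (auto simp: mult_ac intro: mult_nonpos_nonpos)
  next
    case greater
    obtain z where z: "s < z" "z < x" "u x - u s = (x - s) * (H z * \<omega> z)"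
      using mvt[of s x] greater s x by auto
    have Hz: "0 < H z" "H z \<le> B" "0 \<le> \<omega> z" "\<omega> z \<le> \<omega> x"
      using H(2)[of z] B[of z] nonneg[of z] right[of z x] z s x by auto
    then have *: "0 \<le> H z * \<omega> z" "H z * \<omega> z \<le> B * \<omega> x" by (auto intro: mult_mono)
    have "0 \<le> u x - u s" "u x - u s \<le> (x - s) * (B * \<omega> x)"
      unfolding z(3) using * greater by (auto intro!: mult_left_mono)
    then show ?thesis using greater by (auto simp: mult_ac)
  qed simp
  \<comment> \<open>If \<open>\<omega> s = 0\<close>, the quotient \<open>q s = 0 / 0 = 0\<close> still is the continuous extension, by \<open>bound\<close>.\<close>
  have qs: "q s = 0" by (simp add: q_def)
  have qbound: "\<bar>q x\<bar> \<le> B / b\<^sup>2 * \<bar>x - s\<bar>" if x: "x \<in> {0..1}" for x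
  proof (cases "x = s")
    case False
    have w: "\<omega> x > 0" using pos x False by auto
    have "\<bar>q x\<bar> = \<bar>u x - u s\<bar> / \<omega> x / N x"
      using w N(1)[of x] by (simp add: q_def abs_divide abs_of_pos)
    also have "\<dots> \<le> B * \<bar>x - s\<bar> / b\<^sup>2"
    proof (rule frac_le)
      show "\<bar>u x - u s\<bar> / \<omega> x \<le> B * \<bar>x - s\<bar>"
        using bound[OF x] w by (simp add: pos_divide_le_eq mult_ac)
      show "0 \<le> B * \<bar>x - s\<bar>" using H(2)[OF x] B[OF x] by auto
    qed (use b N in auto)
    finally show ?thesis by simp
  qed (simp add: qs)
  have cq: "continuous_on {0..1} q"
    unfolding continuous_on_eq_continuous_within
  proof
    fix x :: real assume x: "x \<in> {0..1}"
    show "continuous (at x within {0..1}) q"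
    proof (cases "x = s")
      case True
      have "(q \<longlongrightarrow> 0) (at s within {0..1})"
      proof (rule Lim_null_comparison)
        show "\<forall>\<^sub>F t in at s within {0..1}. norm (q t) \<le> B / b\<^sup>2 * \<bar>t - s\<bar>"
          using qbound by (auto simp: eventually_at_filter)
        have "((\<lambda>t. B / b\<^sup>2 * \<bar>t - s\<bar>) \<longlongrightarrow> B / b\<^sup>2 * \<bar>s - s\<bar>) (at s within {0..1})"
          by (intro tendsto_intros)
        then show "((\<lambda>t. B / b\<^sup>2 * \<bar>t - s\<bar>) \<longlongrightarrow> 0) (at s within {0..1})" by simp
      qed
      then show ?thesis using True qs by (simp add: continuous_within)
    next
      case False
      then show ?thesis
        unfolding q_def using x pos[of x] N(1)[of x] cu cN c\<omega>
        by (intro continuous_intros) (auto simp: continuous_on_eq_continuous_within)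
    qed
  qed
  \<comment> \<open>\<open>q\<close> need not be differentiable at \<open>s\<close>. Instead of
    integrating its derivative, one compares the values of \<open>Q\<close> at 0, \<open>s\<close>
    and 1; \<open>Q\<close> has a nonnegative derivative on both open pieces.\<close>
  define Q where "Q = (\<lambda>x. integral {0..x} f - q x)"
  have cQ: "continuous_on {0..1} Q"
    unfolding Q_def
    by (intro continuous_on_diff cq indefinite_integral_continuous_1 integrable_continuous_real cf)
  have dQ: "\<exists>d. (Q has_real_derivative d) (at x) \<and> d \<ge> 0" if x: "0 < x" "x < 1" "x \<noteq> s" for x
  proof -
    have w: "\<omega> x > 0" using pos x by auto
    have du: "(u has_real_derivative H x * \<omega> x) (at x)" and dw: "(\<omega> has_real_derivative \<omega>' x) (at x)"
      using u[of x] \<omega>[of x] at[of x] x by auto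
    have dI: "((\<lambda>x. integral {0..x} f) has_real_derivative f x) (at x)"
      using integral_has_real_derivative[OF cf, of x] at[of x] x by auto
    have dN: "(N has_real_derivative 2 * (u x - a) * (H x * \<omega> x)) (at x)"
      unfolding N_def by (auto intro!: derivative_eq_intros du simp: power2_eq_square)
    have nz: "N x * \<omega> x \<noteq> 0" using N(1)[of x] w by simp
    have "((\<lambda>x. (u x - u s) / (N x * \<omega> x)) has_real_derivative
        ((H x * \<omega> x - 0) * (N x * \<omega> x)
          - (u x - u s) * ((2 * (u x - a) * (H x * \<omega> x)) * \<omega> x + \<omega>' x * N x))
        / (N x * \<omega> x * (N x * \<omega> x))) (at x)"
      by (rule DERIV_divide[OF DERIV_diff[OF du DERIV_const] DERIV_mult[OF dN dw] nz])
    also have "((H x * \<omega> x - 0) * (N x * \<omega> x)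
          - (u x - u s) * ((2 * (u x - a) * (H x * \<omega> x)) * \<omega> x + \<omega>' x * N x))
        / (N x * \<omega> x * (N x * \<omega> x))
        = f x - (u x - u s) * \<omega>' x / (N x * (\<omega> x)\<^sup>2)"
      unfolding f_def using N(1)[of x] w by (simp add: divide_simps power2_eq_square) algebra
    finally have dq: "(q has_real_derivative f x - (u x - u s) * \<omega>' x / (N x * (\<omega> x)\<^sup>2)) (at x)"
      by (simp add: q_def)
    have "(Q has_real_derivative (u x - u s) * \<omega>' x / (N x * (\<omega> x)\<^sup>2)) (at x)"
      unfolding Q_def by (auto intro!: derivative_eq_intros dI dq)
    moreover have "0 \<le> (u x - u s) * \<omega>' x / (N x * (\<omega> x)\<^sup>2)"
    proof -
      \<comment> \<open>Both \<open>u x - u s\<close> and \<open>\<omega>' x\<close> have, at least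
        weakly, the sign of \<open>x - s\<close>.\<close>
      have "0 \<le> ((u x - u s) * (x - s)) * (\<omega>' x * (x - s))"
        using bound[of x] sgn[of x] x
        by (intro mult_nonneg_nonneg[of "(u x - u s) * (x - s)"]) auto
      also have "\<dots> = ((u x - u s) * \<omega>' x) * (x - s)\<^sup>2" by (simp add: power2_eq_square)
      finally have "0 \<le> (u x - u s) * \<omega>' x" using x by (simp add: zero_le_mult_iff)
      then show ?thesis using N(1)[of x] by (intro divide_nonneg_nonneg) auto
    qed
    ultimately show ?thesis by blast
  qed
  have cQ': "continuous_on {0..s} Q" "continuous_on {s..1} Q"
    using s by (auto intro: continuous_on_subset[OF cQ])
  have "Q 0 \<le> Q s"
    by (rule DERIV_nonneg_imp_increasing_open[OF _ _ cQ'(1)]) (use s dQ in auto)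
  also have "Q s \<le> Q 1"
    by (rule DERIV_nonneg_imp_increasing_open[OF _ _ cQ'(2)]) (use s dQ in auto)
  finally have "q 1 - q 0 \<le> integral {0..1} f" by (simp add: Q_def)
  moreover have "0 \<le> q 1"
    using bound[of 1] nonneg[of 1] N(1)[of 1] s
    by (cases "s = 1") (auto simp: q_def zero_le_mult_iff intro!: divide_nonneg_nonneg)
  moreover have "q 0 \<le> 0"
    using bound[of 0] nonneg[of 0] N(1)[of 0] s
    by (cases "s = 0") (auto simp: q_def mult_le_0_iff intro!: divide_nonpos_nonneg)
  ultimately show ?thesis by (simp add: f_def N_def)
qed

text \<open>A suitable real linear functional applied to the equation turns it into
  \<open>- g * integral {0..1} G = 1\<close>, whereas \<open>rayleigh_integral_nonneg\<close> makes
  this integral nonnegative.\<close>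

lemma dispersion_nonreal_increasing:
  fixes H u \<omega> \<omega>' :: "real \<Rightarrow> real"
  assumes g: "g > 0" and H: "continuous_on {0..1} H" "\<And>x. x \<in> {0..1} \<Longrightarrow> H x > 0"
    and u: "\<And>x. x \<in> {0..1} \<Longrightarrow> (u has_real_derivative H x * \<omega> x) (at x within {0..1})"
    and \<omega>: "\<And>x. x \<in> {0..1} \<Longrightarrow> (\<omega> has_real_derivative \<omega>' x) (at x within {0..1})"
    and nonneg: "\<And>x. x \<in> {0..1} \<Longrightarrow> \<omega> x \<ge> 0"
    and s: "s \<in> {0..1}" and sgn: "\<And>x. x \<in> {0..1} - {s} \<Longrightarrow> \<omega>' x * (x - s) > 0"
    and c: "Im c \<noteq> 0"
  shows "integral {0..1} (\<lambda>x. complex_of_real (g * H x) / (complex_of_real (u x) - c)\<^sup>2) \<noteq> 1"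
proof
  define a b where "a = Re c" and "b = Im c"
  define F where "F = (\<lambda>x. complex_of_real (g * H x) / (complex_of_real (u x) - c)\<^sup>2)"
  define G where "G = (\<lambda>x. H x *
    (((u x - a)\<^sup>2 + b\<^sup>2 - 2 * (u x - u s) * (u x - a)) / ((u x - a)\<^sup>2 + b\<^sup>2)\<^sup>2))"
  \<comment> \<open>The real functional with \<open>l 1 = 1\<close> that turns the integrand into \<open>- g\<close> times the Rayleigh one.\<close>
  define l where "l = (\<lambda>z. Re z - (u s - a) / b * Im z)"
  assume "integral {0..1} (\<lambda>x. complex_of_real (g * H x) / (complex_of_real (u x) - c)\<^sup>2) = 1"
  then have F1: "integral {0..1} F = 1" by (simp add: F_def)
  have b: "b \<noteq> 0" using c by (simp add: b_def)
  have l: "bounded_linear l"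
    unfolding l_def
    by (intro bounded_linear_sub bounded_linear_const_mult bounded_linear_Re bounded_linear_Im)
  have lF: "l (F x) = - g * G x" for x
  proof -
    define y N where "y = u x - a" and "N = (u x - a)\<^sup>2 + b\<^sup>2"
    have N: "N > 0" using b by (simp add: N_def add_nonneg_pos)
    have nz: "complex_of_real (u x) - c \<noteq> 0"
      using c by (auto simp: complex_eq_iff)
    \<comment> \<open>\<open>Complex y b\<close> is the conjugate of \<open>u x - c\<close>.\<close>
    have "(complex_of_real (u x) - c) * Complex y b = of_real N"
      by (simp add: complex_eq_iff y_def N_def a_def b_def power2_eq_square algebra_simps)
    then have inv: "1 / (complex_of_real (u x) - c) = Complex y b / of_real N"
      using nz N by (simp add: field_simps)
    have "F x = of_real (g * H x) * (1 / (complex_of_real (u x) - c))\<^sup>2"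
      by (simp add: F_def power_divide)
    also have "\<dots> = of_real (g * H x / N\<^sup>2) * (Complex y b)\<^sup>2"
      by (simp add: inv power_divide)
    also have "(Complex y b)\<^sup>2 = Complex (y\<^sup>2 - b\<^sup>2) (2 * y * b)"
      by (simp add: complex_eq_iff power2_eq_square)
    finally have F: "F x = of_real (g * H x / N\<^sup>2) * Complex (y\<^sup>2 - b\<^sup>2) (2 * y * b)" .
    have lmult: "l (of_real r * z) = r * l z" for r z
      by (simp add: l_def algebra_simps)
    have "l (F x) = g * H x / N\<^sup>2 * (y\<^sup>2 - b\<^sup>2 - (u s - a) / b * (2 * y * b))"
      unfolding F lmult by (simp add: l_def)
    \<comment> \<open>Substitute \<open>u s - a = y - (u x - u s)\<close> and
      \<open>N = y\<^sup>2 + b\<^sup>2\<close>.\<close>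
    also have "y\<^sup>2 - b\<^sup>2 - (u s - a) / b * (2 * y * b) = - (N - 2 * (u x - u s) * y)"
      using b by (simp add: N_def y_def field_simps) algebra
    also have "g * H x / N\<^sup>2 * - (N - 2 * (u x - u s) * y)
        = - g * (H x * ((N - 2 * (u x - u s) * y) / N\<^sup>2))"
    proof -
      have "g * h / n * - k = - g * (h * (k / n))" for h n k :: real by simp
      then show ?thesis .
    qed
    finally show ?thesis
      by (simp only: G_def N_def y_def)
  qed
  have cu: "continuous_on {0..1} u" using DERIV_continuous_on[OF u] .
  have "continuous_on {0..1} F"
    unfolding F_def
  proof (intro continuous_intros H cu ballI)
    fix x
    have "Im (complex_of_real (u x) - c) \<noteq> 0" using c by simp
    then show "(complex_of_real (u x) - c)\<^sup>2 \<noteq> 0" by (metis power_eq_0_iff zero_complex.sel(2))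
  qed
  then have "integral {0..1} (l \<circ> F) = l (integral {0..1} F)"
    by (intro integral_linear[OF _ l] integrable_continuous_real)
  also have "l \<circ> F = (\<lambda>x. - g * G x)" by (simp add: fun_eq_iff lF)
  finally have "- g * integral {0..1} G = 1" by (simp add: F1 l_def)
  moreover have "0 \<le> integral {0..1} G"
    unfolding G_def
    by (rule rayleigh_integral_nonneg[of H u \<omega> \<omega>' s b a]) (use H u \<omega> nonneg s sgn b in auto)
  ultimately show False using g by (smt (verit) mult_minus_left mult_nonneg_nonneg)
qed

section \<open>Derivatives and monotonicity on the closed interval\<close>

lemma Ck_I_1D:
  assumes "Ck_I 1 f"
  shows "continuous_on {0..1} f" "continuous_on {0..1} (deriv_I f)"
    "\<And>x. x \<in> {0..1} \<Longrightarrow> (f has_real_derivative deriv_I f x) (at x within {0..1})"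
proof -
  have d: "f differentiable_on {0..1}" and c: "continuous_on {0..1} (deriv_I f)"
    using assms unfolding One_nat_def by simp_all
  show "continuous_on {0..1} f" using d differentiable_imp_continuous_on by blast
  show "continuous_on {0..1} (deriv_I f)" by (rule c)
  show "(f has_real_derivative deriv_I f x) (at x within {0..1})" if "x \<in> {0..1}" for x
    using d that unfolding deriv_I_def differentiable_on_def
    by (simp add: vector_derivative_works has_real_derivative_iff_has_vector_derivative)
qed

lemma deriv_I_eq:
  assumes "x \<in> {0..1}" "(f has_real_derivative d) (at x within {0..1})"
  shows "deriv_I f x = d"
  unfolding deriv_I_def using assms
  by (intro vector_derivative_within_closed_interval)
    (auto simp: has_real_derivative_iff_has_vector_derivative)

lemma lipschitz_I:
  assumes "Ck_I 1 f"
  obtains L where "\<And>x y. x \<in> {0..1} \<Longrightarrow> y \<in> {0..1} \<Longrightarrow> \<bar>f x - f y\<bar> \<le> L * \<bar>x - y\<bar>"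
proof -
  obtain L where L: "\<And>x. x \<in> {0..1} \<Longrightarrow> \<bar>deriv_I f x\<bar> \<le> L"
    using compact_imp_bounded[OF compact_continuous_image[OF Ck_I_1D(2)[OF assms]]]
    unfolding bounded_iff by fastforce
  show ?thesis
  proof
    fix x y :: real assume "x \<in> {0..1}" "y \<in> {0..1}"
    then show "\<bar>f x - f y\<bar> \<le> L * \<bar>x - y\<bar>"
      using field_differentiable_bound[of "{0..1}" f "deriv_I f" L y x] Ck_I_1D(3)[OF assms] L
      by (auto simp: abs_minus_commute)
  qed
qed

lemma continuous_nonvanishing_sign:
  fixes f :: "real \<Rightarrow> real"
  assumes f: "continuous_on {0..1} f" "\<And>x. x \<in> {0..1} \<Longrightarrow> f x \<noteq> 0"
  shows "(\<forall>x\<in>{0..1}. f x > 0) \<or> (\<forall>x\<in>{0..1}. f x < 0)"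
proof (rule ccontr)
  assume "\<not> ?thesis"
  then obtain x y where xy: "x \<in> {0..1}" "y \<in> {0..1}" "f x < 0" "f y > 0"
    using f(2) by (metis less_linear)
  have "connected (f ` {0..1})" using f(1) connected_Icc connected_continuous_image by blast
  then have "0 \<in> f ` {0..1}"
    using connectedD_interval[of "f ` {0..1}" "f x" "f y" 0] xy by auto
  then show False using f(2) by auto
qed

text \<open>The difference quotients are nonnegative. Strict positivity may fail in the limit, which
  is why the vorticity is only known to be nonnegative in the increasing case.\<close>

lemma strict_mono_derivative_nonneg:
  fixes f :: "real \<Rightarrow> real"
  assumes m: "strict_mono_on {0..1} f" and x: "x \<in> {0..1}"
    and d: "(f has_real_derivative d) (at x within {0..1})"
  shows "d \<ge> 0"
proof (rule tendsto_lowerbound)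
  show "((\<lambda>y. (f y - f x) / (y - x)) \<longlongrightarrow> d) (at x within {0..1})"
    using d by (simp add: has_field_derivative_iff)
  show "\<forall>\<^sub>F y in at x within {0..1}. 0 \<le> (f y - f x) / (y - x)"
    unfolding eventually_at_filter
  proof (intro always_eventually allI impI)
    fix y assume "y \<noteq> x" "y \<in> {0..1}"
    then show "0 \<le> (f y - f x) / (y - x)"
      using strict_mono_onD[OF m, of x y] strict_mono_onD[OF m, of y x] x
      by (cases "x < y") (auto simp: zero_le_divide_iff)
  qed
  show "at x within {0..1} \<noteq> bot"
    using x by (simp add: trivial_limit_within islimpt_Icc)
qed

text \<open>Both alternatives of \<open>vort\<close> provide a single point \<open>s\<close> at
  which the derivative of the vorticity changes sign, possibly an endpoint. A decreasing
  \<open>u\<close> is reduced to an increasing one by passing to \<open>- u\<close> and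
  \<open>- c\<close>, which preserves the square in the denominator and negates the
  vorticity.\<close>

lemma dispersion_nonreal:
  assumes g: "g > 0" and HC: "Ck_I 1 H" and H: "\<forall>x\<in>{0..1}. H x > 0" and u: "Ck_I 2 u"
    and mono: "strict_mono_on {0..1} u \<or> strict_antimono_on {0..1} u"
    and vort: "(\<forall>x\<in>{0..1}. deriv_I (vorticity H u) x \<noteq> 0) \<or>
      (\<exists>xc\<in>{0<..<1}. deriv_I (vorticity H u) xc = 0 \<and>
        (\<forall>x\<in>{0..1} - {xc}. deriv_I (vorticity H u) x * (u x - u xc) > 0))"
    and c: "Im c \<noteq> 0"
  shows "integral {0..1} (\<lambda>x. complex_of_real (g * H x) / (complex_of_real (u x) - c)\<^sup>2) \<noteq> 1"
proof -
  have u1: "Ck_I 1 u" and u2: "Ck_I 1 (deriv_I u)"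
    using u differentiable_imp_continuous_on by (auto simp: numeral_2_eq_2)
  note Hd = Ck_I_1D[OF HC] and ud = Ck_I_1D[OF u1] and udd = Ck_I_1D[OF u2]
  define \<omega>' where "\<omega>' = (\<lambda>x. (deriv_I (deriv_I u) x * H x - deriv_I u x * deriv_I H x) / (H x * H x))"
  have H0: "H x \<noteq> 0" if "x \<in> {0..1}" for x using H that by force
  have w: "(vorticity H u has_real_derivative \<omega>' x) (at x within {0..1})" if "x \<in> {0..1}" for x
    unfolding \<omega>'_def vorticity_def [abs_def]
    by (rule DERIV_divide[OF udd(3)[OF that] Hd(3)[OF that] H0[OF that]])
  have w': "deriv_I (vorticity H u) x = \<omega>' x" if "x \<in> {0..1}" for x
    using deriv_I_eq[OF that w[OF that]] .
  have "continuous_on {0..1} \<omega>'"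
    unfolding \<omega>'_def using H0 by (intro continuous_intros Hd ud udd) auto
  then have sign: "(\<forall>x\<in>{0..1}. \<omega>' x > 0) \<or> (\<forall>x\<in>{0..1}. \<omega>' x < 0)"
    if "\<forall>x\<in>{0..1}. deriv_I (vorticity H u) x \<noteq> 0"
    using that w' by (intro continuous_nonvanishing_sign) auto
  have Hw: "H x * vorticity H u x = deriv_I u x" if "x \<in> {0..1}" for x
    using H0[OF that] by (simp add: vorticity_def)
  from mono show ?thesis
  proof
    assume m: "strict_mono_on {0..1} u"
    have um: "u x < u y \<longleftrightarrow> x < y" if "x \<in> {0..1}" "y \<in> {0..1}" for x y
      using strict_mono_onD[OF m] that by (metis less_asym linorder_neqE_linordered_idom)
    \<comment> \<open>A positive \<open>\<omega>'\<close> allows \<open>s = 0\<close>, a negative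
      one \<open>s = 1\<close>; in the second alternative \<open>u x - u s\<close> has the sign of
      \<open>x - s\<close>.\<close>
    have "\<exists>s\<in>{0..1}. \<forall>x\<in>{0..1}-{s}. \<omega>' x * (x - s) > 0"
      using vort
    proof
      assume "\<forall>x\<in>{0..1}. deriv_I (vorticity H u) x \<noteq> 0"
      from sign[OF this] show ?thesis
      proof
        assume "\<forall>x\<in>{0..1}. \<omega>' x > 0" then show ?thesis by (intro bexI[of _ 0]) auto
      next
        assume "\<forall>x\<in>{0..1}. \<omega>' x < 0" then show ?thesis
          by (intro bexI[of _ 1]) (auto intro!: mult_neg_neg)
      qed
    next
      assume "\<exists>xc\<in>{0<..<1}. deriv_I (vorticity H u) xc = 0 \<and>
        (\<forall>x\<in>{0..1} - {xc}. deriv_I (vorticity H u) x * (u x - u xc) > 0)"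
      then obtain s where s: "s \<in> {0<..<1}"
        "\<And>x. x \<in> {0..1} - {s} \<Longrightarrow> \<omega>' x * (u x - u s) > 0" using w' by force
      have "\<omega>' x * (x - s) > 0" if "x \<in> {0..1} - {s}" for x
        using s(2)[OF that] um[of x s] um[of s x] that s(1)
        by (auto simp: zero_less_mult_iff)
      then show ?thesis using s(1) by (intro bexI[of _ s]) auto
    qed
    then obtain s where s: "s \<in> {0..1}" "\<And>x. x \<in> {0..1}-{s} \<Longrightarrow> \<omega>' x * (x - s) > 0" by blast
    show ?thesis
    proof (rule dispersion_nonreal_increasing[OF g Hd(1) _ _ w _ s c])
      show "(u has_real_derivative H x * vorticity H u x) (at x within {0..1})" if "x \<in> {0..1}" for x
        using ud(3)[OF that] Hw[OF that] by simp
      show "0 \<le> vorticity H u x" if "x \<in> {0..1}" for x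
        using strict_mono_derivative_nonneg[OF m that ud(3)[OF that]] H that
        by (simp add: vorticity_def less_imp_le)
    qed (use H in auto)
  next
    assume a: "strict_antimono_on {0..1} u"
    have m: "strict_mono_on {0..1} (\<lambda>x. - u x)"
      using a by (auto simp: monotone_on_def)
    have um: "u x < u y \<longleftrightarrow> y < x" if "x \<in> {0..1}" "y \<in> {0..1}" for x y
      using strict_mono_onD[OF m] that
      by (metis less_asym linorder_neqE_linordered_idom neg_less_iff_less)
    \<comment> \<open>As \<open>u\<close> decreases, \<open>u x - u s\<close> has the sign opposite
      to \<open>x - s\<close>, and the roles of the two endpoints are exchanged.\<close>
    have "\<exists>s\<in>{0..1}. \<forall>x\<in>{0..1}-{s}. - \<omega>' x * (x - s) > 0"
      using vort
    proof
      assume "\<forall>x\<in>{0..1}. deriv_I (vorticity H u) x \<noteq> 0"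
      from sign[OF this] show ?thesis
      proof
        assume "\<forall>x\<in>{0..1}. \<omega>' x > 0" then show ?thesis
          by (intro bexI[of _ 1]) (auto simp: mult_less_0_iff)
      next
        assume "\<forall>x\<in>{0..1}. \<omega>' x < 0" then show ?thesis
          by (intro bexI[of _ 0]) (auto simp: mult_less_0_iff)
      qed
    next
      assume "\<exists>xc\<in>{0<..<1}. deriv_I (vorticity H u) xc = 0 \<and>
        (\<forall>x\<in>{0..1} - {xc}. deriv_I (vorticity H u) x * (u x - u xc) > 0)"
      then obtain s where s: "s \<in> {0<..<1}"
        "\<And>x. x \<in> {0..1} - {s} \<Longrightarrow> \<omega>' x * (u x - u s) > 0" using w' by force
      have "- \<omega>' x * (x - s) > 0" if "x \<in> {0..1} - {s}" for x
        using s(2)[OF that] um[of x s] um[of s x] that s(1)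
        by (auto simp: zero_less_mult_iff mult_less_0_iff)
      then show ?thesis using s(1) by (intro bexI[of _ s]) auto
    qed
    then obtain s where s: "s \<in> {0..1}" "\<And>x. x \<in> {0..1}-{s} \<Longrightarrow> - \<omega>' x * (x - s) > 0" by blast
    have "integral {0..1} (\<lambda>x. complex_of_real (g * H x) / (complex_of_real (- u x) - (- c))\<^sup>2) \<noteq> 1"
    proof (rule dispersion_nonreal_increasing[OF g Hd(1) _ _ _ _ s])
      show "((\<lambda>x. - u x) has_real_derivative H x * (- vorticity H u x)) (at x within {0..1})"
        if "x \<in> {0..1}" for x
        using DERIV_minus[OF ud(3)[OF that]] Hw[OF that] by simp
      show "((\<lambda>x. - vorticity H u x) has_real_derivative - \<omega>' x) (at x within {0..1})"
        if "x \<in> {0..1}" for x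
        using DERIV_minus[OF w[OF that]] .
      show "0 \<le> - vorticity H u x" if "x \<in> {0..1}" for x
        using strict_mono_derivative_nonneg[OF m that DERIV_minus[OF ud(3)[OF that]]] H that
        by (simp add: vorticity_def less_imp_le divide_nonpos_pos)
    qed (use H c in auto)
    moreover have "(complex_of_real (- u x) - (- c))\<^sup>2 = (complex_of_real (u x) - c)\<^sup>2" for x
      by (simp add: power2_eq_square algebra_simps)
    ultimately show ?thesis by simp
  qed
qed

section \<open>Values off the range of the velocity\<close>

locale shear_operator =
  fixes g :: real and H u :: "real \<Rightarrow> real"
  assumes g_nz: "g \<noteq> 0" and H_cont: "continuous_on {0..1} H" and u_cont: "continuous_on {0..1} u"
begin

abbreviation Hc :: "real \<Rightarrow> complex" where "Hc x \<equiv> complex_of_real (H x)"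
abbreviation uc :: "real \<Rightarrow> complex" where "uc x \<equiv> complex_of_real (u x)"

lemma cont_Hc: "continuous_on {0..1} Hc" and cont_uc: "continuous_on {0..1} uc"
  by (intro continuous_intros H_cont u_cont)+

lemma cont_diff: "continuous_on {0..1} (\<lambda>x. uc x - c)"
  by (intro continuous_intros cont_uc)

lemma A0_eq: "A0 g H u (\<phi>, \<psi>) = (mult_op uc \<phi> + mult_op Hc \<psi>,
    const_L2I (of_real g * integral_L2I \<phi>) + mult_op uc \<psi>)"
  unfolding A0_def mult_op_def const_L2I_def integral_L2I_def
  by (simp add: abs_L2I_add square_integrable_const square_integrable_continuous_mult H_cont u_cont)

lemma shift_eq: "shift (A0 g H u) c (\<phi>, \<psi>) = (mult_op (\<lambda>x. uc x - c) \<phi> + mult_op Hc \<psi>,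
    const_L2I (of_real g * integral_L2I \<phi>) + mult_op (\<lambda>x. uc x - c) \<psi>)"
  by (simp add: shift_def A0_eq mult_op_diff_const[OF cont_uc] scaleC_prod_def)

lemma bounded_linear_shift: "bounded_linear (shift (A0 g H u) c)"
proof -
  have "bounded_linear (\<lambda>\<phi>. (mult_op (\<lambda>x. uc x - c) (fst \<phi>) + mult_op Hc (snd \<phi>),
    const_L2I (of_real g * integral_L2I (fst \<phi>)) + mult_op (\<lambda>x. uc x - c) (snd \<phi>)))"
    by (intro bounded_linear_Pair bounded_linear_add
        bounded_linear_compose[OF bounded_linear_mult_op[OF cont_diff]]
        bounded_linear_compose[OF bounded_linear_mult_op[OF cont_Hc]]
        bounded_linear_compose[OF bounded_linear_const_L2I]
        bounded_linear_compose[OF bounded_linear_mult_right]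
        bounded_linear_compose[OF bounded_linear_integral_L2I] bounded_linear_fst bounded_linear_snd)
  moreover have "shift (A0 g H u) c = (\<lambda>\<phi>. (mult_op (\<lambda>x. uc x - c) (fst \<phi>) + mult_op Hc (snd \<phi>),
    const_L2I (of_real g * integral_L2I (fst \<phi>)) + mult_op (\<lambda>x. uc x - c) (snd \<phi>)))"
    by (auto simp: shift_eq fun_eq_iff)
  ultimately show ?thesis by metis
qed

end

locale resolvent_problem = shear_operator +
  fixes c :: complex
  assumes off_range: "\<And>x. x \<in> {0..1} \<Longrightarrow> complex_of_real (u x) \<noteq> c"
begin

abbreviation "T \<equiv> shift (A0 g H u) c"
abbreviation "P \<equiv> mult_op (\<lambda>x. uc x - c)"
abbreviation "R \<equiv> mult_op (\<lambda>x. 1 / (uc x - c))"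
abbreviation "Q \<equiv> mult_op Hc"

definition D :: complex where
  "D = integral {0..1} (\<lambda>x. complex_of_real (g * H x) / (uc x - c)\<^sup>2)"

text \<open>
  Solving \<open>T \<phi> = \<psi>\<close> with \<open>m = \<integral>\<phi>\<^sub>1\<close> regarded as known gives \<open>\<phi> = sol \<psi> m\<close>; this is consistent
  iff \<open>functional \<psi> + D m = m\<close>.
\<close>

definition functional :: "L2I \<times> L2I \<Rightarrow> complex" where
  "functional \<psi> = integral_L2I (R (fst \<psi>)) - integral_L2I (Q (R (R (snd \<psi>))))"

definition sol :: "L2I \<times> L2I \<Rightarrow> complex \<Rightarrow> L2I \<times> L2I" where
  "sol \<psi> m = (R (fst \<psi> - Q (R (snd \<psi> - const_L2I (of_real g * m)))),
     R (snd \<psi> - const_L2I (of_real g * m)))"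

lemma cont_inv: "continuous_on {0..1} (\<lambda>x. 1 / (uc x - c))"
  using off_range by (intro continuous_intros cont_uc) auto

lemma PR: "P (R \<phi>) = \<phi>" and RP: "R (P \<phi>) = \<phi>"
proof -
  have "mult_op (\<lambda>x. (uc x - c) * (1 / (uc x - c))) \<phi> = mult_op (\<lambda>x. 1) \<phi>"
    "mult_op (\<lambda>x. 1 / (uc x - c) * (uc x - c)) \<phi> = mult_op (\<lambda>x. 1) \<phi>"
    using off_range by (auto intro!: mult_op_cong)
  then show "P (R \<phi>) = \<phi>" "R (P \<phi>) = \<phi>"
    by (simp_all only: mult_op_mult_op[OF cont_diff cont_inv] mult_op_mult_op[OF cont_inv cont_diff]
        mult_op_one)
qed

lemma RQ: "R (Q \<phi>) = Q (R \<phi>)"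
  by (simp add: mult_op_mult_op[OF cont_inv cont_Hc] mult_op_mult_op[OF cont_Hc cont_inv])

lemmas bl_Q = bounded_linear_mult_op[OF cont_Hc] and bl_R = bounded_linear_mult_op[OF cont_inv]

lemmas component_simps =
  bounded_linear.linear[OF bl_R, THEN linear_diff] bounded_linear.linear[OF bl_R, THEN linear_add]
  bounded_linear.linear[OF bl_Q, THEN linear_diff] bounded_linear.linear[OF bl_Q, THEN linear_add]
  bounded_linear.linear[OF bl_R, THEN linear_0] bounded_linear.linear[OF bl_Q, THEN linear_0]
  bounded_linear.linear[OF bounded_linear_integral_L2I, THEN linear_diff] integral_L2I_add
  bounded_linear.linear[OF bounded_linear_integral_L2I, THEN linear_0]
  bounded_linear.linear[OF bounded_linear_const_L2I, THEN linear_diff] const_L2I_add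
  bounded_linear.linear[OF bounded_linear_const_L2I, THEN linear_0]

text \<open>This is how \<open>D\<close> arises: the constant \<open>g * m\<close> in the second
  equation feeds \<open>D * m\<close> back into the integral of the first component.\<close>

lemma integral_QRR_const: "integral_L2I (Q (R (R (const_L2I (of_real g * m))))) = D * m"
proof -
  have c2: "continuous_on {0..1} (\<lambda>x. Hc x * (1 / (uc x - c) * (1 / (uc x - c))))"
    by (intro continuous_on_mult cont_inv cont_Hc)
  have "integral_L2I (Q (R (R (const_L2I (of_real g * m)))))
      = integral_L2I (mult_op (\<lambda>x. Hc x * (1 / (uc x - c) * (1 / (uc x - c)))) (const_L2I (of_real g * m)))"
    by (simp only: mult_op_mult_op[OF cont_inv cont_inv]
        mult_op_mult_op[OF cont_Hc continuous_on_mult[OF cont_inv cont_inv]])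
  also have "\<dots> = integral {0..1} (\<lambda>x. Hc x * (1 / (uc x - c) * (1 / (uc x - c)))) * (of_real g * m)"
    by (simp only: integral_mult_op_const[OF c2] unit_measure_continuous(2)[OF c2])
  also have "\<dots> = (of_real g * integral {0..1} (\<lambda>x. Hc x * (1 / (uc x - c) * (1 / (uc x - c))))) * m"
    by (simp only: ac_simps)
  also have "of_real g * integral {0..1} (\<lambda>x. Hc x * (1 / (uc x - c) * (1 / (uc x - c)))) = D"
    unfolding D_def integral_mult_right[symmetric] by (simp add: power2_eq_square)
  finally show ?thesis .
qed

text \<open>\<open>functional\<close> eliminates the second component; what remains of
  \<open>T \<phi> = \<psi>\<close> is one scalar equation for the integral of
  \<open>fst \<phi>\<close>.\<close>

lemma functional_shift: "functional (T \<phi>) = (1 - D) * integral_L2I (fst \<phi>)"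
  by (cases \<phi>) (simp add: functional_def shift_eq component_simps RP RQ integral_QRR_const algebra_simps)

lemma integral_fst_sol: "integral_L2I (fst (sol \<psi> m)) = functional \<psi> + D * m"
  by (simp add: sol_def functional_def component_simps RQ integral_QRR_const)

text \<open>By construction the first equation holds exactly. The second fails only by the
  difference between the actual integral, given by \<open>integral_fst_sol\<close>, and the presumed
  value \<open>m\<close>.\<close>

lemma shift_sol: "T (sol \<psi> m) = \<psi> + (0, const_L2I (of_real g * (functional \<psi> + D * m - m)))"
proof -
  have "T (sol \<psi> m) = (fst \<psi>, snd \<psi>
    + (const_L2I (of_real g * integral_L2I (fst (sol \<psi> m))) - const_L2I (of_real g * m)))"
    unfolding sol_def shift_eq by (simp add: PR)
  then show ?thesis
    unfolding integral_fst_sol by (simp add: prod_eq_iff right_diff_distrib component_simps)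
qed

text \<open>Thus \<open>\<phi>\<close> is determined by \<open>T \<phi>\<close> and one scalar, so
  the kernel is at most a line.\<close>

lemma sol_shift: "sol (T \<phi>) (integral_L2I (fst \<phi>)) = \<phi>"
  by (cases \<phi>) (simp add: sol_def shift_eq RP)

lemma bounded_linear_functional: "bounded_linear functional"
  unfolding functional_def [abs_def]
  by (intro bounded_linear_sub bounded_linear_compose[OF bounded_linear_integral_L2I]
      bounded_linear_compose[OF bl_Q] bounded_linear_compose[OF bl_R]
      bounded_linear_fst bounded_linear_snd)

lemma functional_scaleC: "functional (scaleC a \<psi>) = a * functional \<psi>"
  by (simp add: functional_def scaleC_prod_def mult_op_scaleC[OF cont_inv] mult_op_scaleC[OF cont_Hc] integral_L2I_scaleC
      right_diff_distrib)

text \<open>The consistency equation \<open>functional \<psi> + D * m = m\<close> has exactly one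
  solution \<open>m\<close>, and inserting it into \<open>sol\<close> gives a bounded
  inverse.\<close>

lemma invertible_if_D_neq_1:
  assumes "D \<noteq> 1"
  shows "invertible_op T"
  unfolding invertible_op_def
proof (intro exI conjI allI)
  show "bounded_linear (\<lambda>\<psi>. sol \<psi> (functional \<psi> / (1 - D)))"
    unfolding sol_def divide_inverse[of "functional _"]
    by (intro bounded_linear_Pair bounded_linear_sub
        bounded_linear_compose[OF bl_Q] bounded_linear_compose[OF bl_R]
        bounded_linear_compose[OF bounded_linear_const_L2I]
        bounded_linear_compose[OF bounded_linear_mult_right]
        bounded_linear_compose[OF bounded_linear_mult_left]
        bounded_linear_functional bounded_linear_fst bounded_linear_snd)
  show "sol (T \<phi>) (functional (T \<phi>) / (1 - D)) = \<phi>" for \<phi>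
    using assms by (simp add: functional_shift sol_shift)
  have "functional \<psi> + D * (functional \<psi> / (1 - D)) - functional \<psi> / (1 - D) = 0" for \<psi>
    using assms by (simp add: field_simps)
  then show "T (sol \<psi> (functional \<psi> / (1 - D))) = \<psi>" for \<psi>
    by (simp add: shift_sol component_simps flip: zero_prod_def)
qed

lemma sol_zero_scaleC: "sol 0 m = scaleC m (sol 0 1)"
proof -
  have k: "const_L2I (of_real g * m) = scaleC m (const_L2I (of_real g))"
    using const_L2I_mult[of m "of_real g"] by (simp add: mult.commute)
  show ?thesis
    by (simp add: sol_def scaleC_prod_def k mult_op_scaleC[OF cont_inv] mult_op_scaleC[OF cont_Hc]
        bounded_linear.linear[OF bl_R, THEN linear_neg] bounded_linear.linear[OF bl_Q, THEN linear_neg])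
qed

text \<open>Consistency now demands \<open>functional \<psi> = 0\<close> and leaves \<open>m\<close>
  free: the kernel is the line through \<open>sol 0 1\<close>, and the range is the closed
  hyperplane where \<open>functional\<close> vanishes.\<close>

lemma eigenvalue_if_D_eq_1:
  assumes "D = 1"
  shows "\<not> inj T" "fredholm_op T"
proof -
  have T0: "T 0 = 0"
    using bounded_linear.linear[OF bounded_linear_shift] by (rule linear_0)
  have l0: "functional 0 = 0"
    using bounded_linear.linear[OF bounded_linear_functional] by (rule linear_0)
  have ker: "T (sol 0 m) = 0" for m
    by (simp add: shift_sol assms l0 component_simps flip: zero_prod_def)
  \<comment> \<open>The first component of \<open>sol 0 1\<close> has integral
    \<open>D = 1\<close>.\<close>
  have nz: "sol 0 1 \<noteq> 0"
    using integral_fst_sol[of 0 1] by (auto simp: assms l0 component_simps)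
  show "\<not> inj T"
    using injD[of T "sol 0 1" 0] nz unfolding ker T0 by blast
  have "{\<phi>. T \<phi> = 0} = complex_vector.span {sol 0 1}"
  proof (intro set_eqI iffI)
    fix \<phi> assume "\<phi> \<in> {\<phi>. T \<phi> = 0}"
    then have "\<phi> = sol 0 (integral_L2I (fst \<phi>))" using sol_shift[of \<phi>] by simp
    then show "\<phi> \<in> complex_vector.span {sol 0 1}"
      by (metis complex_vector.span_base complex_vector.span_scale singletonI sol_zero_scaleC)
  next
    fix \<phi> assume "\<phi> \<in> complex_vector.span {sol 0 1}"
    then obtain m where "\<phi> = scaleC m (sol 0 1)"
      by (auto simp: complex_vector.span_singleton)
    then show "\<phi> \<in> {\<phi>. T \<phi> = 0}" using ker by (simp flip: sol_zero_scaleC)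
  qed
  moreover have range: "range T = functional -` {0}"
  proof (intro set_eqI iffI)
    fix \<psi> assume "\<psi> \<in> functional -` {0}"
    then have "T (sol \<psi> 0) = \<psi>"
      by (simp add: shift_sol component_simps flip: zero_prod_def)
    then show "\<psi> \<in> range T" by (metis rangeI)
  qed (auto simp: functional_shift assms)
  have "closed (range T)"
    unfolding range
    by (intro closed_vimage linear_continuous_on bounded_linear_functional) auto
  moreover have "complex_vector.span (range T \<union> {(0, const_L2I 1)}) = UNIV"
  proof (intro set_eqI iffI UNIV_I)
    fix \<psi> :: "L2I \<times> L2I"
    define e where "e = (0 :: L2I, const_L2I 1)"
    \<comment> \<open>\<open>e\<close> spans a complement of the range, because
      \<open>g * functional e = - D = - 1\<close>.\<close>
    have "of_real g * functional e = - (D * 1)"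
      using functional_scaleC[of "of_real g" e] integral_QRR_const[of 1]
        const_L2I_mult[of "of_real g" 1]
      by (simp add: e_def functional_def scaleC_prod_def component_simps)
    then have e: "functional e \<noteq> 0" using assms by auto
    define a where "a = functional \<psi> / functional e"
    have "functional (\<psi> - scaleC a e) = 0"
      using e bounded_linear.linear[OF bounded_linear_functional, THEN linear_diff]
      by (simp add: functional_scaleC a_def)
    then have "\<psi> - scaleC a e \<in> complex_vector.span (range T \<union> {e})"
      by (intro complex_vector.span_base) (simp add: range)
    moreover have "scaleC a e \<in> complex_vector.span (range T \<union> {e})"
      by (intro complex_vector.span_scale complex_vector.span_base) simp
    ultimately have "\<psi> - scaleC a e + scaleC a e \<in> complex_vector.span (range T \<union> {e})"
      by (rule complex_vector.span_add)
    then show "\<psi> \<in> complex_vector.span (range T \<union> {(0, const_L2I 1)})"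
      by (simp add: e_def)
  qed
  ultimately show "fredholm_op T"
    unfolding fredholm_op_def by (meson finite.emptyI finite.insertI)
qed

end

section \<open>Values in the range of the velocity\<close>

locale critical_value = shear_operator +
  fixes p L :: real
  assumes p: "p \<in> {0..1}" and inj: "\<And>x. x \<in> {0..1} \<Longrightarrow> u x = u p \<Longrightarrow> x = p"
    and lip: "\<And>x. x \<in> {0..1} \<Longrightarrow> \<bar>u x - u p\<bar> \<le> L * \<bar>x - p\<bar>"
begin

abbreviation "P \<equiv> mult_op (\<lambda>x. uc x - uc p)"
abbreviation "T \<equiv> shift (A0 g H u) (uc p)"

text \<open>A continuous regularisation of \<open>1 / (u x - u p)\<^sup>2\<close>. It detects that
  \<open>1 / (u - u p)\<close> is not square integrable, yields an approximate inverse of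
  \<open>P\<close> after multiplication by \<open>u - u p\<close>, and becomes a bump near
  \<open>p\<close> after normalisation.\<close>

definition approx_kernel :: "real \<Rightarrow> real \<Rightarrow> real" where
  "approx_kernel e x = 1 / ((u x - u p)\<^sup>2 + e\<^sup>2)"

lemma kernel_pos: "e > 0 \<Longrightarrow> approx_kernel e x > 0"
  by (simp add: approx_kernel_def add_nonneg_pos)

lemma cont_kernel: "e > 0 \<Longrightarrow> continuous_on {0..1} (approx_kernel e)"
  unfolding approx_kernel_def
  by (intro continuous_intros u_cont) (metis add_nonneg_pos less_irrefl zero_le_power2 zero_less_power)

lemma integral_kernel_ge:
  assumes "0 < e" "e \<le> 1/2"
  shows "1 / ((L\<^sup>2 + 1) * e) \<le> (LINT x|unit_measure. approx_kernel e x)"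
proof -
  have "1 / ((L\<^sup>2 + 1) * e) \<le> integral {0..1} (approx_kernel e)"
    unfolding approx_kernel_def [abs_def]
    by (intro integral_inverse_square_ge[OF _ p lip] continuous_intros u_cont assms)
  then show ?thesis
    by (simp add: unit_measure_continuous(2)[OF cont_kernel[OF assms(1)]])
qed

text \<open>Off \<open>p\<close>, \<open>\<phi>\<close> equals \<open>k / (u - u p)\<close>, so its
  squared modulus dominates \<open>(cmod k)\<^sup>2 * approx_kernel e\<close> for every
  \<open>e\<close>. The integrals of these minorants are unbounded unless
  \<open>k = 0\<close>.\<close>

lemma mult_op_eq_const:
  assumes "P \<phi> = const_L2I k"
  shows "k = 0"
proof (rule ccontr)
  assume k: "k \<noteq> 0"
  have AE: "AE x in unit_measure. (uc x - uc p) * rep_L2I \<phi> x = k"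
    using rep_mult_op[OF cont_diff, of "uc p" \<phi>] rep_L2I_const[of k] unfolding assms
    by eventually_elim simp
  have le: "(cmod k)\<^sup>2 * (1 / ((L\<^sup>2 + 1) * e)) \<le> (norm \<phi>)\<^sup>2" if e: "0 < e" "e \<le> 1/2" for e
  proof -
    have "(cmod k)\<^sup>2 * (1 / ((L\<^sup>2 + 1) * e)) \<le> (LINT x|unit_measure. (cmod k)\<^sup>2 * approx_kernel e x)"
      unfolding integral_mult_right_zero by (intro mult_left_mono integral_kernel_ge e) auto
    also have "\<dots> \<le> (LINT x|unit_measure. (cmod (rep_L2I \<phi> x))\<^sup>2)"
    proof (rule integral_mono_AE)
      show "integrable unit_measure (\<lambda>x. (cmod k)\<^sup>2 * approx_kernel e x)"
        using unit_measure_continuous(1)[OF cont_kernel[OF e(1)]] by simp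
      show "AE x in unit_measure. (cmod k)\<^sup>2 * approx_kernel e x \<le> (cmod (rep_L2I \<phi> x))\<^sup>2"
        using AE
      proof eventually_elim
        case (elim x)
        have "cmod k = \<bar>u x - u p\<bar> * cmod (rep_L2I \<phi> x)"
          unfolding elim[symmetric] norm_mult by (simp flip: of_real_diff)
        then have "(cmod k)\<^sup>2 = (u x - u p)\<^sup>2 * (cmod (rep_L2I \<phi> x))\<^sup>2"
          by (simp add: power_mult_distrib)
        also have "\<dots> \<le> ((u x - u p)\<^sup>2 + e\<^sup>2) * (cmod (rep_L2I \<phi> x))\<^sup>2"
          by (intro mult_right_mono) auto
        finally show ?case
          using e by (simp add: approx_kernel_def pos_divide_le_eq add_nonneg_pos mult.commute)
      qed
    qed (rule integrable_rep_sq)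
    finally show ?thesis by (simp add: norm_L2I_rep)
  qed
  define a where "a = (cmod k)\<^sup>2 / (L\<^sup>2 + 1)"
  have a: "a > 0" using k by (simp add: a_def add_nonneg_pos)
  \<comment> \<open>With this choice \<open>a / e \<ge> (norm \<phi>)\<^sup>2 + 1\<close>, which
    contradicts \<open>le\<close>.\<close>
  define e where "e = min (1/2) (a / ((norm \<phi>)\<^sup>2 + 1))"
  have nn: "(norm \<phi>)\<^sup>2 + 1 > 0" by (simp add: add_nonneg_pos)
  have e: "0 < e" "e \<le> 1/2" "e \<le> a / ((norm \<phi>)\<^sup>2 + 1)"
    using a nn unfolding e_def by (simp, linarith, linarith)
  have "a / e \<le> (norm \<phi>)\<^sup>2"
    using le[OF e(1,2)] by (simp add: a_def)
  then have "a \<le> (norm \<phi>)\<^sup>2 * e" using e(1) by (simp add: pos_divide_le_eq)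
  moreover have "((norm \<phi>)\<^sup>2 + 1) * e \<le> a"
    using e(3) nn by (simp add: pos_le_divide_eq mult.commute)
  ultimately show False using e(1) by (simp add: algebra_simps)
qed

lemma AE_off_p: "AE x in unit_measure. u x \<noteq> u p"
proof -
  have "{p} \<inter> {0<..<1} \<in> null_sets unit_measure"
    by (subst null_sets_restrict_space) (auto intro!: null_sets_completionI finite_imp_null_set_lborel)
  then have "AE x in unit_measure. x \<notin> {p} \<inter> {0<..<1}" by (rule AE_not_in)
  moreover have "AE x in unit_measure. x \<in> {0<..<1}" by (rule AE_I2) simp
  ultimately show ?thesis
  proof eventually_elim
    case (elim x)
    then show ?case using inj[of x] by auto
  qed
qed

lemma mult_op_eq_0:
  assumes "P \<phi> = 0"
  shows "\<phi> = 0"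
  unfolding L2I_eq_iff
  using rep_mult_op[OF cont_diff, of "uc p" \<phi>] AE_off_p rep_L2I_zero unfolding assms
  by eventually_elim (simp flip: of_real_diff)

text \<open>The second equation makes \<open>P \<phi>2\<close> constant, hence zero, so
  \<open>\<phi>2 = 0\<close>; the first one then reads \<open>P \<phi>1 = 0\<close>.\<close>

lemma T_inj: "inj T"
proof -
  have "\<phi> = 0" if "T \<phi> = 0" for \<phi>
  proof (cases \<phi>)
    case (Pair \<phi>1 \<phi>2)
    have eq: "P \<phi>1 + mult_op Hc \<phi>2 = 0" "const_L2I (of_real g * integral_L2I \<phi>1) + P \<phi>2 = 0"
      using that by (simp_all add: Pair shift_eq zero_prod_def)
    have "P \<phi>2 = - const_L2I (of_real g * integral_L2I \<phi>1)"
      using eq(2) by (simp add: eq_neg_iff_add_eq_0 add.commute)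
    also have "\<dots> = const_L2I (- (of_real g * integral_L2I \<phi>1))"
      using bounded_linear.linear[OF bounded_linear_const_L2I] by (simp add: linear_neg)
    finally have P2: "P \<phi>2 = const_L2I (- (of_real g * integral_L2I \<phi>1))" .
    then have "- (of_real g * integral_L2I \<phi>1) = 0" by (rule mult_op_eq_const)
    then have "P \<phi>2 = 0"
      using bounded_linear.linear[OF bounded_linear_const_L2I] unfolding P2 by (metis linear_0)
    then have "\<phi>2 = 0" by (rule mult_op_eq_0)
    then have "P \<phi>1 = 0"
      using eq(1) bounded_linear.linear[OF bounded_linear_mult_op[OF cont_Hc]] by (simp add: linear_0)
    then have "\<phi>1 = 0" by (rule mult_op_eq_0)
    with \<open>\<phi>2 = 0\<close> show ?thesis by (simp add: Pair zero_prod_def)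
  qed
  then show ?thesis
    using bounded_linear.linear[OF bounded_linear_shift] by (simp add: linear_injective_0)
qed

text \<open>For a preimage, \<open>P \<phi>2\<close> would be constant, so
  \<open>\<phi>2 = 0\<close> and \<open>g\<close> times the integral of \<open>\<phi>1\<close> would
  be 1. But then the first equation gives \<open>\<phi>1 = 0\<close>.\<close>

lemma T_not_surj: "(0, const_L2I 1) \<notin> range T"
proof
  assume "(0, const_L2I 1) \<in> range T"
  then obtain \<phi>1 \<phi>2 where eq: "P \<phi>1 + mult_op Hc \<phi>2 = 0"
    "const_L2I (of_real g * integral_L2I \<phi>1) + P \<phi>2 = const_L2I 1"
    by (auto simp: shift_eq)
  have "P \<phi>2 = const_L2I 1 - const_L2I (of_real g * integral_L2I \<phi>1)"
    using eq(2) by (metis add_diff_cancel_left')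
  also have "\<dots> = const_L2I (1 - of_real g * integral_L2I \<phi>1)"
    using bounded_linear.linear[OF bounded_linear_const_L2I] by (simp add: linear_diff)
  finally have P2: "P \<phi>2 = const_L2I (1 - of_real g * integral_L2I \<phi>1)" .
  then have k: "1 - of_real g * integral_L2I \<phi>1 = 0" by (rule mult_op_eq_const)
  then have "P \<phi>2 = 0"
    using P2 bounded_linear.linear[OF bounded_linear_const_L2I] by (simp add: linear_0)
  then have "\<phi>2 = 0" by (rule mult_op_eq_0)
  then have "P \<phi>1 = 0"
    using eq(1) bounded_linear.linear[OF bounded_linear_mult_op[OF cont_Hc]] by (simp add: linear_0)
  then have "\<phi>1 = 0" by (rule mult_op_eq_0)
  then show False
    using k bounded_linear.linear[OF bounded_linear_integral_L2I] by (simp add: linear_0)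
qed

section \<open>Density of the range\<close>

lemma mult_op_approx:
  assumes "0 < (e::real)"
  shows "\<exists>\<phi>. norm (P \<phi> - \<psi>) < e"
proof -
  define r where "r = (\<lambda>n::nat. inverse (real (Suc n)))"
  have r: "r n > 0" for n by (simp add: r_def)
  \<comment> \<open>Regularised division by \<open>u - u p\<close>. The relative error
    \<open>(r n)\<^sup>2 * approx_kernel (r n) x\<close> is at most 1 and tends to 0 off
    \<open>p\<close>, so dominated convergence applies.\<close>
  define \<phi> where "\<phi> = (\<lambda>n. mult_op (\<lambda>x. of_real ((u x - u p) * approx_kernel (r n) x)) \<psi>)"
  have cv: "continuous_on {0..1} (\<lambda>x. complex_of_real ((u x - u p) * approx_kernel (r n) x))" for n
    by (intro continuous_intros u_cont cont_kernel r)
  have cw: "continuous_on {0..1} (\<lambda>x. (uc x - uc p) * complex_of_real ((u x - u p) * approx_kernel (r n) x))" for n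
    by (intro continuous_on_mult cont_diff cv)
  have cw1: "continuous_on {0..1} (\<lambda>x. (uc x - uc p) * complex_of_real ((u x - u p) * approx_kernel (r n) x) - 1)" for n
    by (intro continuous_on_diff cw continuous_on_const)
  have val: "cmod ((uc x - uc p) * complex_of_real ((u x - u p) * approx_kernel (r n) x) - 1)
      = (r n)\<^sup>2 * approx_kernel (r n) x" for x n
  proof -
    have nz: "(u x - u p)\<^sup>2 + (r n)\<^sup>2 > 0" using r[of n] by (simp add: add_nonneg_pos)
    have "approx_kernel (r n) x * ((u x - u p)\<^sup>2 + (r n)\<^sup>2) = 1"
      using less_imp_neq[OF nz] by (simp add: approx_kernel_def del: sum_power2_eq_zero_iff)
    then have "(u x - u p) * ((u x - u p) * approx_kernel (r n) x) - 1 = - ((r n)\<^sup>2 * approx_kernel (r n) x)"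
      by algebra
    moreover have "(uc x - uc p) * complex_of_real ((u x - u p) * approx_kernel (r n) x) - 1
      = of_real ((u x - u p) * ((u x - u p) * approx_kernel (r n) x) - 1)" by simp
    ultimately show ?thesis
      using kernel_pos[OF r, of n x] by (simp add: norm_mult norm_power)
  qed
  have diff: "P (\<phi> n) - \<psi> = mult_op (\<lambda>x. (uc x - uc p) * complex_of_real ((u x - u p) * approx_kernel (r n) x) - 1) \<psi>" for n
    unfolding \<phi>_def mult_op_mult_op[OF cont_diff cv] mult_op_diff_const[OF cw]
    by (simp add: scaleC_one)
  have "(\<lambda>n. (norm (P (\<phi> n) - \<psi>))\<^sup>2) \<longlonglongrightarrow> (LINT x|unit_measure. 0)"
    unfolding diff norm_mult_op[OF cw1] val
  proof (rule integral_dominated_convergence)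
    show "integrable unit_measure (\<lambda>x. (cmod (rep_L2I \<psi> x))\<^sup>2)" by (rule integrable_rep_sq)
    show "(\<lambda>x. ((r n)\<^sup>2 * approx_kernel (r n) x * cmod (rep_L2I \<psi> x))\<^sup>2) \<in> borel_measurable unit_measure" for n
    proof -
      have [measurable]: "approx_kernel (r n) \<in> borel_measurable unit_measure"
        by (intro continuous_imp_measurable_on_sets_lebesgue
            continuous_on_subset[OF cont_kernel[OF r]]) auto
      show ?thesis by measurable
    qed
    show "AE x in unit_measure. norm (((r n)\<^sup>2 * approx_kernel (r n) x * cmod (rep_L2I \<psi> x))\<^sup>2)
        \<le> (cmod (rep_L2I \<psi> x))\<^sup>2" for n
    proof (rule AE_I2)
      fix x
      have "0 \<le> (r n)\<^sup>2 * approx_kernel (r n) x"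
        using kernel_pos[OF r, of n x] by simp
      moreover have "(r n)\<^sup>2 * approx_kernel (r n) x \<le> 1"
        using r[of n] by (simp add: approx_kernel_def divide_le_eq add_nonneg_pos)
      ultimately have "((r n)\<^sup>2 * approx_kernel (r n) x)\<^sup>2 \<le> 1" by (simp add: power_le_one)
      then show "norm (((r n)\<^sup>2 * approx_kernel (r n) x * cmod (rep_L2I \<psi> x))\<^sup>2) \<le> (cmod (rep_L2I \<psi> x))\<^sup>2"
        using mult_right_mono[of "((r n)\<^sup>2 * approx_kernel (r n) x)\<^sup>2" 1 "(cmod (rep_L2I \<psi> x))\<^sup>2"]
        by (simp add: power_mult_distrib)
    qed
    show "AE x in unit_measure. (\<lambda>n. ((r n)\<^sup>2 * approx_kernel (r n) x * cmod (rep_L2I \<psi> x))\<^sup>2) \<longlonglongrightarrow> 0"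
      using AE_off_p
    proof eventually_elim
      case (elim x)
      have "r \<longlonglongrightarrow> 0" unfolding r_def by (rule LIMSEQ_inverse_real_of_nat)
      then have "(\<lambda>n. ((r n)\<^sup>2 * (1 / ((u x - u p)\<^sup>2 + (r n)\<^sup>2)) * cmod (rep_L2I \<psi> x))\<^sup>2)
          \<longlonglongrightarrow> (0\<^sup>2 * (1 / ((u x - u p)\<^sup>2 + 0\<^sup>2)) * cmod (rep_L2I \<psi> x))\<^sup>2"
        using elim by (intro tendsto_intros) auto
      then show ?case by (simp add: approx_kernel_def)
    qed
  qed simp
  then have "\<forall>\<^sub>F n in sequentially. (norm (P (\<phi> n) - \<psi>))\<^sup>2 < e\<^sup>2"
    by (rule order_tendstoD(2)) (use assms in simp)
  then obtain n where "(norm (P (\<phi> n) - \<psi>))\<^sup>2 < e\<^sup>2"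
    by (meson eventually_sequentially order_refl)
  then show ?thesis
    using assms power_less_imp_less_base[of _ 2 e] by (meson less_imp_le)
qed

text \<open>Take \<open>approx_kernel d\<close> divided by its integral \<open>N\<close>. Since
  \<open>(u x - u p)\<^sup>2 * approx_kernel d x \<le> 1\<close>, the squared norm of its image
  under \<open>P\<close> is at most \<open>1 / N\<close>, hence at most
  \<open>(L\<^sup>2 + 1) * d\<close>.\<close>

lemma delta_sequence:
  assumes "0 < (e::real)"
  shows "\<exists>\<eta>. integral_L2I \<eta> = 1 \<and> norm (P \<eta>) < e"
proof -
  have L1: "L\<^sup>2 + 1 > 0" by (simp add: add_nonneg_pos)
  define d where "d = min (1/2) (e\<^sup>2 / (2 * (L\<^sup>2 + 1)))"
  have d: "0 < d" "d \<le> 1/2" "d \<le> e\<^sup>2 / (2 * (L\<^sup>2 + 1))"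
    using assms L1 unfolding d_def by (simp, linarith, linarith)
  have "(L\<^sup>2 + 1) * d \<le> e\<^sup>2 / 2"
    using d(3) L1 by (simp add: field_simps)
  also have "\<dots> < e\<^sup>2" using assms by simp
  finally have Ld: "(L\<^sup>2 + 1) * d < e\<^sup>2" .
  define N where "N = (LINT x|unit_measure. approx_kernel d x)"
  have N: "1 / ((L\<^sup>2 + 1) * d) \<le> N" unfolding N_def by (rule integral_kernel_ge[OF d(1,2)])
  have Npos: "N > 0"
    by (rule less_le_trans[OF _ N]) (use d L1 in auto)
  have ck: "continuous_on {0..1} (\<lambda>x. complex_of_real (approx_kernel d x))"
    by (intro continuous_intros cont_kernel d)
  have cuk: "continuous_on {0..1} (\<lambda>x. (uc x - uc p) * complex_of_real (approx_kernel d x))"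
    by (intro continuous_on_mult cont_diff ck)
  define \<eta> where "\<eta> = mult_op (\<lambda>x. complex_of_real (approx_kernel d x)) (const_L2I (1 / of_real N))"
  have "(LINT x|unit_measure. complex_of_real (approx_kernel d x)) = of_real N"
    unfolding N_def by simp
  then have int: "integral_L2I \<eta> = 1"
    unfolding \<eta>_def integral_mult_op_const[OF ck] using Npos by simp
  have "(norm (P \<eta>))\<^sup>2 = (LINT x|unit_measure.
      (cmod ((uc x - uc p) * complex_of_real (approx_kernel d x)) * cmod (rep_L2I (const_L2I (1 / of_real N)) x))\<^sup>2)"
    unfolding \<eta>_def mult_op_mult_op[OF cont_diff ck] norm_mult_op[OF cuk] ..
  also have "\<dots> \<le> (LINT x|unit_measure. approx_kernel d x * (1 / N)\<^sup>2)"
  proof (rule integral_mono_AE')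
    show "integrable unit_measure (\<lambda>x. approx_kernel d x * (1 / N)\<^sup>2)"
      using unit_measure_continuous(1)[OF cont_kernel[OF d(1)]] by simp
    show "AE x in unit_measure. (cmod ((uc x - uc p) * complex_of_real (approx_kernel d x))
        * cmod (rep_L2I (const_L2I (1 / of_real N)) x))\<^sup>2 \<le> approx_kernel d x * (1 / N)\<^sup>2"
      using rep_L2I_const[of "1 / of_real N"]
    proof eventually_elim
      case (elim x)
      have k: "approx_kernel d x > 0" by (rule kernel_pos[OF d(1)])
      have "(u x - u p)\<^sup>2 * approx_kernel d x \<le> 1"
        using d by (simp add: approx_kernel_def divide_le_eq add_nonneg_pos)
      then have "(u x - u p)\<^sup>2 * approx_kernel d x * approx_kernel d x \<le> 1 * approx_kernel d x"
        using k by (intro mult_right_mono) auto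
      then have "(cmod ((uc x - uc p) * complex_of_real (approx_kernel d x)))\<^sup>2 \<le> approx_kernel d x"
        by (simp add: norm_mult power_mult_distrib power2_eq_square flip: of_real_diff)
           (simp add: mult_ac abs_mult_self_eq)
      then show ?case
        using Npos by (simp add: elim power_mult_distrib norm_divide divide_right_mono power_divide)
    qed
    show "AE x in unit_measure. 0 \<le> approx_kernel d x * (1 / N)\<^sup>2"
      using kernel_pos[OF d(1)] by (intro AE_I2 mult_nonneg_nonneg) (auto simp: less_imp_le)
  qed
  also have "\<dots> = 1 / N"
    using Npos by (simp add: N_def[symmetric] power2_eq_square)
  also have "\<dots> \<le> (L\<^sup>2 + 1) * d"
    using N Npos mult_pos_pos[OF L1 d(1)] by (simp only: pos_divide_le_eq mult.commute)
  finally have "(norm (P \<eta>))\<^sup>2 < e\<^sup>2" using Ld by simp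
  then have "norm (P \<eta>) < e"
    using assms by (meson less_imp_le power_less_imp_less_base)
  with int show ?thesis by blast
qed

text \<open>
  Solving the two equations approximately with \<open>mult_op_approx\<close> ignores the coupling through
  \<open>\<integral>\<phi>\<^sub>1\<close>; subtracting a multiple of the bump makes this integral vanish at little cost.
\<close>

lemma T_dense: "closure (range T) = UNIV"
proof (intro set_eqI iffI UNIV_I)
  fix \<psi> :: "L2I \<times> L2I"
  obtain \<psi>1 \<psi>2 where \<psi>: "\<psi> = (\<psi>1, \<psi>2)" by (cases \<psi>)
  show "\<psi> \<in> closure (range T)"
    unfolding closure_approachable
  proof (intro allI impI)
    fix e :: real assume e: "e > 0"
    obtain \<phi>2 where \<phi>2: "norm (P \<phi>2 - \<psi>2) < e / 3"
      using mult_op_approx[of "e / 3" \<psi>2] e by auto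
    obtain \<phi> where \<phi>: "norm (P \<phi> - (\<psi>1 - mult_op Hc \<phi>2)) < e / 3"
      using mult_op_approx[of "e / 3"] e by auto
    define m where "m = integral_L2I \<phi>"
    \<comment> \<open>Dividing by \<open>cmod m + 1\<close> instead of \<open>cmod m\<close> covers
      \<open>m = 0\<close> as well.\<close>
    have m1: "cmod m + 1 > 0" by (simp add: add_nonneg_pos)
    obtain \<eta> where \<eta>: "integral_L2I \<eta> = 1" "norm (P \<eta>) < e / 3 / (cmod m + 1)"
      using delta_sequence[of "e / 3 / (cmod m + 1)"] e m1 by auto
    define \<phi>1 where "\<phi>1 = \<phi> - scaleC m \<eta>"
    have int: "integral_L2I \<phi>1 = 0"
      using bounded_linear.linear[OF bounded_linear_integral_L2I]
      by (simp add: \<phi>1_def linear_diff integral_L2I_scaleC \<eta> m_def)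
    have P1: "P \<phi>1 = P \<phi> - scaleC m (P \<eta>)"
      using bounded_linear.linear[OF bounded_linear_mult_op[OF cont_diff]]
      by (simp add: \<phi>1_def linear_diff mult_op_scaleC[OF cont_diff])
    have "norm (scaleC m (P \<eta>)) \<le> (cmod m + 1) * norm (P \<eta>)"
      by (simp add: norm_scaleC mult_right_mono)
    also have "\<dots> < e / 3"
      using \<eta>(2) unfolding pos_less_divide_eq[OF m1] by (simp add: mult.commute)
    finally have \<eta>': "norm (scaleC m (P \<eta>)) < e / 3" .
    \<comment> \<open>The coupling constant drops out because \<open>\<phi>1\<close> has integral
      zero.\<close>
    have "T (\<phi>1, \<phi>2) - \<psi> = ((P \<phi> - (\<psi>1 - mult_op Hc \<phi>2)) - scaleC m (P \<eta>), P \<phi>2 - \<psi>2)"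
      using bounded_linear.linear[OF bounded_linear_const_L2I]
      by (simp add: shift_eq \<psi> int P1 linear_0)
    then have "norm (T (\<phi>1, \<phi>2) - \<psi>)
        \<le> norm ((P \<phi> - (\<psi>1 - mult_op Hc \<phi>2)) - scaleC m (P \<eta>)) + norm (P \<phi>2 - \<psi>2)"
      using norm_Pair_le by metis
    also have "\<dots> \<le> norm (P \<phi> - (\<psi>1 - mult_op Hc \<phi>2)) + norm (scaleC m (P \<eta>)) + norm (P \<phi>2 - \<psi>2)"
      by (intro add_right_mono norm_triangle_ineq4)
    also have "\<dots> < e" using \<phi>2 \<phi> \<eta>' by simp
    finally show "\<exists>y\<in>range T. dist y \<psi> < e"
      by (metis dist_norm rangeI)
  qed
qed

text \<open>A closed dense range would be the whole space.\<close>

lemma T_not_fredholm: "\<not> fredholm_op T"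
  using T_not_surj T_dense unfolding fredholm_op_def by (metis UNIV_I closure_closed)

end

section \<open>The spectra\<close>

lemma invertible_opD:
  assumes "invertible_op T"
  shows "inj T" "range T = UNIV" "fredholm_op T"
proof -
  obtain S where S: "bounded_linear S" "\<And>x. S (T x) = x" "\<And>x. T (S x) = x"
    using assms by (auto simp: invertible_op_def)
  show "inj T" using S(2) by (rule inj_on_inverseI)
  show r: "range T = UNIV" using S(3) by (rule surjI)
  have "S 0 = 0" using S(1) by (simp add: bounded_linear.linear linear_0)
  then have "T x = 0 \<longleftrightarrow> x = 0" for x using S(2)[of x] S(3)[of 0] by auto
  then have "{x. T x = 0} = complex_vector.span {}" by simp
  moreover have "complex_vector.span (range T \<union> {}) = UNIV" by (simp add: r)
  ultimately show "fredholm_op T"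
    unfolding fredholm_op_def using r by (intro conjI exI[of _ "{}"]) auto
qed

lemma closure_unit_interval: "closure {0<..<1::real} = {0..1}"
  by simp

text \<open>The infimum runs over the open interval while the minimum may sit at an endpoint;
  continuity extends lower bounds to the closure.\<close>

lemma u_minus_eq:
  assumes u: "continuous_on {0..1} u" and p: "p \<in> {0..1}" "\<forall>x\<in>{0..1}. u p \<le> u x"
  shows "u_minus u = u p"
  unfolding u_minus_def
proof (rule cInf_eq)
  fix y assume y: "\<And>x. x \<in> u ` {0<..<1} \<Longrightarrow> y \<le> x"
  show "y \<le> u p"
    by (rule continuous_ge_on_closure[of "{0<..<1}" u])
      (use u p y in \<open>simp_all only: closure_unit_interval imageI\<close>)
qed (use p in auto)

lemma u_plus_eq:
  assumes u: "continuous_on {0..1} u" and p: "p \<in> {0..1}" "\<forall>x\<in>{0..1}. u x \<le> u p"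
  shows "u_plus u = u p"
  unfolding u_plus_def
proof (rule cSup_eq)
  fix y assume y: "\<And>x. x \<in> u ` {0<..<1} \<Longrightarrow> x \<le> y"
  show "u p \<le> y"
    by (rule continuous_le_on_closure[of "{0<..<1}" u])
      (use u p y in \<open>simp_all only: closure_unit_interval imageI\<close>)
qed (use p in auto)

section \<open>Identification of the two real eigenvalues\<close>

lemma dispersion_iff:
  assumes "continuous_on {0..1} H" "continuous_on {0..1} u" "\<And>x. x \<in> {0..1} \<Longrightarrow> u x \<noteq> c"
  shows "dispersion g H u c \<longleftrightarrow> integral {0..1} (\<lambda>x. g * H x / (c - u x)\<^sup>2) = 1"
proof -
  have "continuous_on {0..1} (\<lambda>x. g * H x / (c - u x)\<^sup>2)"
    using assms(3) by (intro continuous_intros assms) fastforce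
  then show ?thesis by (simp add: dispersion_def unit_measure_continuous(2))
qed

text \<open>\<open>dispersion_root\<close> justifies the definite description. Its uniqueness covers
  all \<open>c < u p\<close>, so there is no root to the left of \<open>J_minus\<close>
  either.\<close>

lemma c_minus_characterization:
  assumes g: "g > 0" and H: "continuous_on {0..1} H" "\<forall>x\<in>{0..1}. H x > 0"
    and u: "continuous_on {0..1} u" and p: "p \<in> {0..1}" "\<forall>x\<in>{0..1}. u p \<le> u x"
    and L: "\<forall>x\<in>{0..1}. \<bar>u x - u p\<bar> \<le> L * \<bar>x - p\<bar>"
  shows "c_minus g H u \<in> J_minus g H u"
    and "c < u p \<Longrightarrow> dispersion g H u c \<longleftrightarrow> c = c_minus g H u"
proof -
  have disp: "dispersion g H u c \<longleftrightarrow> integral {0..1} (\<lambda>x. g * H x / (c - u x)\<^sup>2) = 1"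
    if "c < u p" for c
    using p(2) that by (intro dispersion_iff H u) force
  have J: "J_minus g H u = {u p - sqrt (g * integral {0..1} H)..<u p}"
    unfolding J_minus_def u_minus_eq[OF u p] depth_def unit_measure_continuous(2)[OF H(1)] ..
  obtain c0 where c0: "c0 \<in> J_minus g H u" "dispersion g H u c0"
    "\<And>c. c < u p \<Longrightarrow> dispersion g H u c \<Longrightarrow> c = c0"
    using dispersion_root[OF g H(1) _ u p(1), of L] H(2) p(2) L disp unfolding J by auto
  have "c_minus g H u = c0"
    unfolding c_minus_def using c0 by (intro the_equality) (auto simp: J)
  then show "c_minus g H u \<in> J_minus g H u"
    and "c < u p \<Longrightarrow> dispersion g H u c \<longleftrightarrow> c = c_minus g H u"
    using c0 by auto
qed

text \<open>The reflection of \<open>u\<close> and \<open>c\<close> to \<open>- u\<close> and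
  \<open>- c\<close> preserves the dispersion relation and exchanges \<open>J_plus\<close> with
  \<open>J_minus\<close>.\<close>

lemma c_plus_characterization:
  assumes g: "g > 0" and H: "continuous_on {0..1} H" "\<forall>x\<in>{0..1}. H x > 0"
    and u: "continuous_on {0..1} u" and p: "p \<in> {0..1}" "\<forall>x\<in>{0..1}. u x \<le> u p"
    and L: "\<forall>x\<in>{0..1}. \<bar>u x - u p\<bar> \<le> L * \<bar>x - p\<bar>"
  shows "c_plus g H u \<in> J_plus g H u"
    and "u p < c \<Longrightarrow> dispersion g H u c \<longleftrightarrow> c = c_plus g H u"
proof -
  define v where "v = (\<lambda>x. - u x)"
  have v: "continuous_on {0..1} v" unfolding v_def by (intro continuous_intros u)
  have pv: "\<forall>x\<in>{0..1}. v p \<le> v x" using p by (simp add: v_def)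
  have Lv: "\<forall>x\<in>{0..1}. \<bar>v x - v p\<bar> \<le> L * \<bar>x - p\<bar>"
    using L by (simp add: v_def abs_minus_commute)
  note cm = c_minus_characterization[OF g H v p(1) pv Lv]
  have disp: "dispersion g H v (- c) \<longleftrightarrow> dispersion g H u c" for c
    by (simp add: dispersion_def v_def power2_commute[of "u _" c])
  have J: "c \<in> J_plus g H u \<longleftrightarrow> - c \<in> J_minus g H v" for c
    using u_minus_eq[OF v p(1) pv] u_plus_eq[OF u p]
    by (auto simp: J_minus_def J_plus_def v_def)
  have "c_plus g H u = - c_minus g H v"
    unfolding c_plus_def
  proof (rule the_equality)
    have "c_minus g H v < v p"
      using cm(1) u_minus_eq[OF v p(1) pv] by (simp add: J_minus_def)
    then show "- c_minus g H v \<in> J_plus g H u \<and> dispersion g H u (- c_minus g H v)"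
      using cm disp[of "- c_minus g H v"] by (simp add: J)
    fix c assume c: "c \<in> J_plus g H u \<and> dispersion g H u c"
    then have "- c < v p"
      using u_plus_eq[OF u p] by (auto simp: J_plus_def v_def)
    then show "c = - c_minus g H v"
      using cm(2)[of "- c"] c disp[of c] by auto
  qed
  then show "c_plus g H u \<in> J_plus g H u"
    and "u p < c \<Longrightarrow> dispersion g H u c \<longleftrightarrow> c = c_plus g H u"
    using cm(1) cm(2)[of "- c"] disp[of c] by (auto simp: J v_def)
qed

lemma (in resolvent_problem) D_of_real:
  assumes "c = complex_of_real r"
  shows "D = 1 \<longleftrightarrow> dispersion g H u r"
proof -
  have r: "u x \<noteq> r" if "x \<in> {0..1}" for x using off_range[OF that] assms by auto
  have cont: "continuous_on {0..1} (\<lambda>x. g * H x / (r - u x)\<^sup>2)"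
    using r by (intro continuous_intros H_cont u_cont) fastforce
  have "D = integral {0..1} (complex_of_real \<circ> (\<lambda>x. g * H x / (r - u x)\<^sup>2))"
    unfolding D_def by (intro integral_cong) (simp add: assms power2_commute[of r])
  also have "\<dots> = complex_of_real (integral {0..1} (\<lambda>x. g * H x / (r - u x)\<^sup>2))"
    by (intro integral_linear integrable_continuous_real cont bounded_linear_of_real)
  finally show ?thesis
    using dispersion_iff[OF H_cont u_cont r] by simp
qed

theorem proposition4p9:
  fixes g :: real and H u :: "real \<Rightarrow> real"
  assumes g_pos: "g > 0"
    and H_C1: "Ck_I 1 H"
    and H_pos: "\<forall>x\<in>{0..1}. H x > 0"
    and u_C2: "Ck_I 2 u"
    and u_strict: "strict_mono_on {0..1} u \<or> strict_antimono_on {0..1} u"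
    and vort: "(\<forall>x\<in>{0..1}. deriv_I (vorticity H u) x \<noteq> 0) \<or>
      (\<exists>xc\<in>{0<..<1}. deriv_I (vorticity H u) xc = 0 \<and>
        (\<forall>x\<in>{0..1} - {xc}. deriv_I (vorticity H u) x * (u x - u xc) > 0))"
  shows "c_minus g H u \<in> J_minus g H u \<and> c_plus g H u \<in> J_plus g H u \<and>
    point_spectrum (A0 g H u)
      = {complex_of_real (c_minus g H u), complex_of_real (c_plus g H u)} \<and>
    discrete_spectrum (A0 g H u)
      = {complex_of_real (c_minus g H u), complex_of_real (c_plus g H u)} \<and>
    continuous_spectrum (A0 g H u) = complex_of_real ` u ` {0..1} \<and>
    essential_spectrum (A0 g H u) = complex_of_real ` u ` {0..1} \<and>
    residual_spectrum (A0 g H u) = {}"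
proof -
  have u_C1: "Ck_I 1 u"
    using u_C2 differentiable_imp_continuous_on by (auto simp: numeral_2_eq_2)
  have H: "continuous_on {0..1} H" and u: "continuous_on {0..1} u"
    using Ck_I_1D(1) H_C1 u_C1 by auto
  obtain L where L: "\<And>x y. x \<in> {0..1} \<Longrightarrow> y \<in> {0..1} \<Longrightarrow> \<bar>u x - u y\<bar> \<le> L * \<bar>x - y\<bar>"
    using lipschitz_I[OF u_C1] by blast
  have inj: "x = y" if "x \<in> {0..1}" "y \<in> {0..1}" "u x = u y" for x y
    using u_strict that unfolding monotone_on_def by (metis less_irrefl linorder_neqE)
  obtain p where p: "p \<in> {0..1}" "\<forall>x\<in>{0..1}. u p \<le> u x"
    using continuous_attains_inf[OF compact_Icc _ u] by fastforce
  obtain q where q: "q \<in> {0..1}" "\<forall>x\<in>{0..1}. u x \<le> u q"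
    using continuous_attains_sup[OF compact_Icc _ u] by fastforce
  have Lp: "\<forall>x\<in>{0..1}. \<bar>u x - u p\<bar> \<le> L * \<bar>x - p\<bar>" "\<forall>x\<in>{0..1}. \<bar>u x - u q\<bar> \<le> L * \<bar>x - q\<bar>"
    using L p(1) q(1) by auto
  note cm = c_minus_characterization[OF g_pos H H_pos u p Lp(1)]
  note cp = c_plus_characterization[OF g_pos H H_pos u q Lp(2)]
  have cm_less: "c_minus g H u < u p" and cp_greater: "u q < c_plus g H u"
    using cm(1) cp(1) by (simp_all add: J_minus_def J_plus_def u_minus_eq[OF u p] u_plus_eq[OF u q])
  interpret shear_operator g H u
    using g_pos H u by unfold_locales auto
  define E where "E = {complex_of_real (c_minus g H u), complex_of_real (c_plus g H u)}"
  define R where "R = complex_of_real ` u ` {0..1}"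
  have disjoint: "c \<notin> R" if "c \<in> E" for c
    using that cm_less cp_greater p(2) q(2) unfolding E_def R_def by force
  have on_range: "inj (shift (A0 g H u) c)" "range (shift (A0 g H u) c) \<noteq> UNIV"
    "closure (range (shift (A0 g H u) c)) = UNIV" "\<not> fredholm_op (shift (A0 g H u) c)"
    if c: "c \<in> R" for c
  proof -
    obtain s where s: "s \<in> {0..1}" "c = complex_of_real (u s)"
      using c unfolding R_def by blast
    interpret critical_value g H u s L
      by unfold_locales (use s(1) L inj[OF _ s(1)] in blast)+
    show "inj (shift (A0 g H u) c)" "range (shift (A0 g H u) c) \<noteq> UNIV"
      "closure (range (shift (A0 g H u) c)) = UNIV" "\<not> fredholm_op (shift (A0 g H u) c)"
      unfolding s(2) using T_inj T_not_surj T_dense T_not_fredholm by auto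
  qed
  have off: "(c \<in> E \<longrightarrow> \<not> inj (shift (A0 g H u) c) \<and> fredholm_op (shift (A0 g H u) c)) \<and>
    (c \<notin> E \<longrightarrow> invertible_op (shift (A0 g H u) c))"
    if c: "c \<notin> R" for c
  proof -
    interpret resolvent_problem g H u c
      by unfold_locales (use c in \<open>auto simp: R_def\<close>)
    have "D = 1 \<longleftrightarrow> c \<in> E"
    proof (cases "Im c = 0")
      case True
      define r where "r = Re c"
      have r: "c = complex_of_real r" using True by (simp add: complex_eq_iff r_def)
      have "r \<notin> u ` {0..1}" using c r by (auto simp: R_def)
      moreover have "connected (u ` {0..1})"
        using u connected_Icc connected_continuous_image by blast
      \<comment> \<open>The range of \<open>u\<close> is connected, so a real number outside it lies
        below its minimum or above its maximum.\<close>
      ultimately have "\<not> (u p \<le> r \<and> r \<le> u q)"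
        using p(1) q(1) connectedD_interval[of "u ` {0..1}" "u p" "u q" r] by blast
      moreover have pq: "u p \<le> u q" using p(2) q(1) by blast
      ultimately consider "r < u p" | "u q < r" by linarith
      then have "dispersion g H u r \<longleftrightarrow> r = c_minus g H u \<or> r = c_plus g H u"
      proof cases
        case 1
        then have "r \<noteq> c_plus g H u" using pq cp_greater by linarith
        then show ?thesis using cm(2)[OF 1] by blast
      next
        case 2
        then have "r \<noteq> c_minus g H u" using pq cm_less by linarith
        then show ?thesis using cp(2)[OF 2] by blast
      qed
      then show ?thesis using D_of_real[OF r] by (simp add: r E_def)
    next
      case False
      \<comment> \<open>This is where the vorticity condition enters.\<close>
      then have "D \<noteq> 1"
        unfolding D_def using dispersion_nonreal[OF g_pos H_C1 H_pos u_C2 u_strict vort] by blast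
      moreover have "c \<notin> E" using False by (auto simp: E_def)
      ultimately show ?thesis by blast
    qed
    then show ?thesis using invertible_if_D_neq_1 eigenvalue_if_D_eq_1 by blast
  qed
  have "(c \<in> point_spectrum (A0 g H u) \<longleftrightarrow> c \<in> E) \<and> (c \<in> discrete_spectrum (A0 g H u) \<longleftrightarrow> c \<in> E) \<and>
    (c \<in> continuous_spectrum (A0 g H u) \<longleftrightarrow> c \<in> R) \<and> (c \<in> essential_spectrum (A0 g H u) \<longleftrightarrow> c \<in> R) \<and>
    c \<notin> residual_spectrum (A0 g H u)" for c
  proof -
    note defs = point_spectrum_def discrete_spectrum_def continuous_spectrum_def
      essential_spectrum_def residual_spectrum_def mem_Collect_eq
    \<comment> \<open>The plane splits into \<open>R\<close>, \<open>E\<close> and the rest; on each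
      piece the facts above decide membership in all five spectra.\<close>
    consider "c \<in> R" "c \<notin> E" | "c \<in> E" "c \<notin> R" | "c \<notin> R" "c \<notin> E"
      using disjoint by blast
    then show ?thesis
    proof cases
      case 1
      then show ?thesis using on_range[OF 1(1)] unfolding defs by simp
    next
      case 2
      then have T: "\<not> inj (shift (A0 g H u) c)" "fredholm_op (shift (A0 g H u) c)" using off by simp_all
      then have "\<not> invertible_op (shift (A0 g H u) c)" using invertible_opD(1) by blast
      with T 2 show ?thesis unfolding defs by simp
    next
      case 3
      then have T: "invertible_op (shift (A0 g H u) c)" using off by simp
      with 3 show ?thesis using invertible_opD[OF T] unfolding defs by simp
    qed
  qed
  note spectra = this
  have "point_spectrum (A0 g H u) = E" "discrete_spectrum (A0 g H u) = E"
    "continuous_spectrum (A0 g H u) = R" "essential_spectrum (A0 g H u) = R"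
    "residual_spectrum (A0 g H u) = {}"
    by (rule set_eqI, use spectra in simp)+
  then show ?thesis
    using cm(1) cp(1) by (simp add: E_def R_def)
qed

end
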